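(* Let $n\ge 2$ be an integer and let $1<p<\infty$ be given, with $p\neq 2$ and $p\neq n$. Then there is no function $\rho:(0,\infty)\to\mathbb{R}$, $\rho\not\equiv 0$, with the following property: for every domain $G\subset\mathbb{R}^n$ and every $p$-harmonic function $u$ in $G$, the function $$v(x)=\rho(|x|)\,u\Bigl(\frac{x}{|x|^2}\Bigr)$$ is $p$-harmonic in the reflected domain $G^{\ast}$.
   Context: A domain is a nonempty open connected set, and $|x|$ is the Euclidean norm on $\mathbb{R}^n$. For $1<p<\infty$ and $G\subset\mathbb{R}^n$ a domain, a function $u\in W^{1,p}_{\mathrm{loc}}(G)$ is $p$-harmonic in $G$ if it is a weak solution of $\mathrm{div}(|\nabla u|^{p-2}\nabla u)=0$, i.e. $\int_G |\nabla u|^{p-2}\nabla u\cdot\nabla\eta\,dx=0$ for all $\eta\in C_0^\infty(G)$ (with $|\nabla u|^{p-2}\nabla u$ read as $0$ where $\nabla u=0$). Weak solutions are equivalent to functions of class $C^{1,\alpha}_{\mathrm{loc}}(G)$ for some $\alpha=\alpha(n,p)>0$; the term "$p$-harmonic function" refers to this continuous representative, so a $p$-harmonic function is a genuine continuous function. The reflection (inversion) in the unit sphere is $x^{\ast}=x/|x|^2$, and the reflected domain is $G^{\ast}=\{x\in\mathbb{R}^n\setminus\{0\}: x/|x|^2\in G\}$ (if $0\in G$, the point $0^{\ast}=\infty$ is disregarded). *)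

theory Defs
  imports "HOL-Analysis.Analysis"
begin

definition grad :: "('a::euclidean_space \<Rightarrow> real) \<Rightarrow> 'a \<Rightarrow> 'a" where
  "grad f x = (\<Sum>b\<in>Basis. frechet_derivative f (at x) b *\<^sub>R b)"

primrec Ck :: "nat \<Rightarrow> ('a::euclidean_space \<Rightarrow> real) \<Rightarrow> bool" where
  "Ck 0 f \<longleftrightarrow> continuous_on UNIV f"
| "Ck (Suc k) f \<longleftrightarrow>
     (\<forall>x. f differentiable (at x)) \<and>
     (\<forall>b\<in>Basis. Ck k (\<lambda>x. frechet_derivative f (at x) b))"

text \<open>Elements of \<open>C\<^sub>0\<^sup>\<infinity>(G)\<close> are represented by their extension by zero to the whole space.\<close>

definition test_function :: "'a::euclidean_space set \<Rightarrow> ('a \<Rightarrow> real) \<Rightarrow> bool" where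
  "test_function G \<eta> \<longleftrightarrow>
     (\<forall>k. Ck k \<eta>) \<and> compact (closure {x. \<eta> x \<noteq> 0}) \<and> closure {x. \<eta> x \<noteq> 0} \<subseteq> G"

definition Lp_loc ::
    "real \<Rightarrow> 'a::euclidean_space set \<Rightarrow> ('a \<Rightarrow> 'b::euclidean_space) \<Rightarrow> bool" where
  "Lp_loc p G f \<longleftrightarrow>
     f \<in> borel_measurable (lebesgue_on G) \<and>
     (\<forall>K. compact K \<and> K \<subseteq> G \<longrightarrow> integrable (lebesgue_on K) (\<lambda>x. norm (f x) powr p))"

definition weak_gradient ::
    "'a::euclidean_space set \<Rightarrow> ('a \<Rightarrow> real) \<Rightarrow> ('a \<Rightarrow> 'a) \<Rightarrow> bool" where
  "weak_gradient G u g \<longleftrightarrow>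
     (\<forall>\<eta>. test_function G \<eta> \<longrightarrow>
        (LINT x|lebesgue_on G. u x *\<^sub>R grad \<eta> x) = - (LINT x|lebesgue_on G. \<eta> x *\<^sub>R g x))"

text \<open>
  The existential quantifier over \<open>g\<close> combines membership of \<open>u\<close> in the local Sobolev space
  with the equation for its weak gradient, which is unique up to null sets. Continuity selects the
  continuous representative. The flux is zero where \<open>g x = 0\<close>, since \<open>0 *\<^sub>R 0 = 0\<close>.
\<close>

definition p_harmonic ::
    "real \<Rightarrow> 'a::euclidean_space set \<Rightarrow> ('a \<Rightarrow> real) \<Rightarrow> bool" where
  "p_harmonic p G u \<longleftrightarrow>
     continuous_on G u \<and> Lp_loc p G u \<and>
     (\<exists>g. Lp_loc p G g \<and> weak_gradient G u g \<and>
        (\<forall>\<eta>. test_function G \<eta> \<longrightarrow>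
           (LINT x|lebesgue_on G. (norm (g x) powr (p - 2) *\<^sub>R g x) \<bullet> grad \<eta> x) = 0))"

definition inversion :: "'a::euclidean_space \<Rightarrow> 'a" where
  "inversion x = x /\<^sub>R (norm x)\<^sup>2"

definition reflected :: "'a::euclidean_space set \<Rightarrow> 'a set" where
  "reflected G = {x. x \<noteq> 0 \<and> inversion x \<in> G}"

end

theory Submission
  imports Defs
begin

text \<open>
  Write \<open>n\<close> for the dimension and \<open>\<beta> = (p - n) / (p - 1)\<close>, which is nonzero. Three p-harmonic functions
  refute every candidate \<open>\<rho>\<close>.

  The constant \<open>1\<close> shows that \<open>\<rho>(|x|)\<close> itself is p-harmonic off the origin, and a radial p-harmonic
  function has the form \<open>A r\<^sup>\<beta> + B\<close> (\<open>radial_p_harmonic\<close>). The fundamental solution \<open>|x|\<^sup>\<beta>\<close> shows that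
  \<open>(A r\<^sup>\<beta> + B) r\<^sup>-\<^sup>\<beta> = A + B r\<^sup>-\<^sup>\<beta>\<close> has this form as well, which forces \<open>B = 0\<close>. Finally a coordinate
  \<open>x \<bullet> e\<close> is turned into \<open>V x = A |x|\<^sup>\<gamma> (x \<bullet> e)\<close> with \<open>\<gamma> = \<beta> - 2\<close>. This function is smooth off the
  origin and its gradient never vanishes there, so it would satisfy the equation pointwise; but the
  divergence of its flux is a nowhere vanishing factor times
  \<open>(p - 2) \<gamma> \<beta> (x \<bullet> e) (|x|\<^sup>2 - (x \<bullet> e)\<^sup>2)\<close>, where \<open>p \<noteq> 2\<close>, \<open>\<gamma> \<noteq> 0\<close> and \<open>\<beta> \<noteq> 0\<close>;
  in dimension at least two the last two factors do not vanish identically (\<open>inverted_coordinate_not_p_harmonic\<close>).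

  The delicate point is the form of \<open>\<rho>\<close>, because \<open>\<rho>(|x|)\<close> is only known to be continuous with a weak
  gradient \<open>g\<close>. Instead of passing to polar coordinates and an ordinary differential equation, the
  proof exploits dilations. Since \<open>\<rho>(|x|)\<close> does not change along spheres, \<open>g x\<close> is almost everywhere
  parallel to \<open>x\<close> (\<open>radial_weak_gradient\<close>). Hence the flux is \<open>f(x) x\<close> for a scalar function \<open>f\<close>, and the
  equation becomes \<open>\<integral> f (x \<bullet> \<nabla>\<eta>) = 0\<close>. In distributional form this is Euler's identity for functions that
  are homogeneous of degree \<open>- n\<close>. Therefore \<open>f\<close>, and with it \<open>g\<close>, is homogeneous almost everywhere
  (\<open>weakly_homogeneous_imp_homogeneous\<close>), the degree of \<open>g\<close> being \<open>\<beta> - 1\<close>. Consequently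
  \<open>\<rho>(t |x|) - t\<^sup>\<beta> \<rho>(|x|)\<close> has weak gradient zero and is constant for each \<open>t > 0\<close>. Exchanging the roles of
  \<open>t\<close> and \<open>|x|\<close> in this functional equation gives \<open>A r\<^sup>\<beta> + B\<close>.

  All statements that hold almost everywhere rest on the fundamental lemma of the calculus of
  variations for locally integrable functions (\<open>fundamental_lemma\<close>).
\<close>

section \<open>Smooth functions and test functions\<close>

lemma Ck_SucI:
  fixes f :: "'a::euclidean_space \<Rightarrow> real"
  assumes "\<And>x. (f has_derivative D x) (at x)" and "\<And>b. b \<in> Basis \<Longrightarrow> Ck k (\<lambda>x. D x b)"
  shows "Ck (Suc k) f"
proof -
  have "frechet_derivative f (at x) = D x" for x
    using frechet_derivative_at[OF assms(1)] by simp
  with assms show ?thesis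
    by (auto intro: differentiableI)
qed

lemma Ck_SucD: "Ck (Suc k) f \<Longrightarrow> Ck k f"
proof (induction k arbitrary: f)
  case 0
  then show ?case
    by (auto intro!: differentiable_imp_continuous_on simp: differentiable_on_def)
next
  case (Suc k)
  then show ?case by (metis Ck.simps(2))
qed

lemma Ck_derivative:
  assumes "Ck (Suc k) f"
  shows "(f has_derivative frechet_derivative f (at x)) (at x)"
  using assms by (auto simp: frechet_derivative_works)

lemma Ck_const: "Ck k (\<lambda>x. c)"
  by (induction k arbitrary: c) (auto intro!: Ck_SucI[where D="\<lambda>_ _. 0"])

lemma Ck_inner: "Ck k (\<lambda>x. x \<bullet> v)"
proof (cases k)
  case (Suc m)
  show ?thesis
    unfolding Suc by (rule Ck_SucI[where D="\<lambda>_ h. h \<bullet> v"]) (auto intro!: derivative_eq_intros Ck_const)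
qed (auto intro!: continuous_intros)

lemma Ck_add:
  assumes "Ck k f" "Ck k g"
  shows "Ck k (\<lambda>x. f x + g x)"
  using assms
proof (induction k arbitrary: f g)
  case (Suc k)
  show ?case
    by (rule Ck_SucI[where D="\<lambda>x h. frechet_derivative f (at x) h + frechet_derivative g (at x) h"])
       (use Suc in \<open>auto intro!: derivative_eq_intros simp: frechet_derivative_works[symmetric]\<close>)
qed (auto intro!: continuous_intros)

lemma Ck_mult:
  assumes "Ck k f" "Ck k g"
  shows "Ck k (\<lambda>x. f x * g x)"
  using assms
proof (induction k arbitrary: f g)
  case (Suc k)
  have df: "(f has_derivative frechet_derivative f (at x)) (at x)"
    and dg: "(g has_derivative frechet_derivative g (at x)) (at x)" for x
    using Suc.prems Ck_derivative by blast+
  show ?case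
  proof (rule Ck_SucI)
    show "((\<lambda>x. f x * g x) has_derivative
        (\<lambda>h. f x * frechet_derivative g (at x) h + frechet_derivative f (at x) h * g x)) (at x)" for x
      by (rule has_derivative_mult[OF df dg])
    show "Ck k (\<lambda>x. f x * frechet_derivative g (at x) b + frechet_derivative f (at x) b * g x)"
      if "b \<in> Basis" for b
      using Suc.prems that by (intro Ck_add Suc.IH Ck_SucD[of k f] Ck_SucD[of k g]) auto
  qed
qed (auto intro!: continuous_intros)

lemma Ck_prod:
  assumes "\<And>i. i \<in> I \<Longrightarrow> Ck k (f i)"
  shows "Ck k (\<lambda>x. \<Prod>i\<in>I. f i x)"
  using assms by (induction I rule: infinite_finite_induct) (auto intro: Ck_const Ck_mult)

lemma Ck_dilate:
  assumes "Ck k f"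
  shows "Ck k (\<lambda>x. f (c *\<^sub>R x))"
  using assms
proof (induction k arbitrary: f)
  case 0
  then have "continuous_on UNIV (f \<circ> (\<lambda>x. c *\<^sub>R x))"
    by (intro continuous_on_compose continuous_intros) (auto intro: continuous_on_subset)
  then show ?case by (simp add: o_def)
next
  case (Suc k)
  have lin: "linear (frechet_derivative f (at x))" for x
    using Ck_derivative[OF Suc.prems] has_derivative_linear by blast
  show ?case
  proof (rule Ck_SucI)
    show "((\<lambda>x. f (c *\<^sub>R x)) has_derivative (\<lambda>h. frechet_derivative f (at (c *\<^sub>R x)) (c *\<^sub>R h))) (at x)" for x
      by (rule has_derivative_compose[OF _ Ck_derivative[OF Suc.prems]]) (auto intro!: derivative_eq_intros)
    show "Ck k (\<lambda>x. frechet_derivative f (at (c *\<^sub>R x)) (c *\<^sub>R b))" if "b \<in> Basis" for b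
    proof -
      have "Ck k (\<lambda>x. c * frechet_derivative f (at (c *\<^sub>R x)) b)"
        using Suc that by (intro Ck_mult Ck_const Suc.IH) auto
      then show ?thesis by (simp add: linear_scale[OF lin])
    qed
  qed
qed

text \<open>The family \<open>t\<^sup>-\<^sup>m exp (- 1 / t)\<close>, extended by zero, is used in place of \<open>exp (- 1 / t)\<close> alone
  because it is closed under differentiation up to linear combinations; smoothness then follows by an
  induction that treats all \<open>m\<close> at once.\<close>

definition flat :: "nat \<Rightarrow> real \<Rightarrow> real" where
  "flat m t = (if t \<le> 0 then 0 else (1 / t) ^ m * exp (- (1 / t)))"

lemma flat_tendsto_0: "((\<lambda>t. flat m t) \<longlongrightarrow> 0) (at 0)"
proof -
  have "((\<lambda>y::real. y ^ m / exp y) \<longlongrightarrow> 0) at_top"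
    by (rule tendsto_power_div_exp_0)
  then have "((\<lambda>t::real. (inverse t) ^ m / exp (inverse t)) \<longlongrightarrow> 0) (at_right 0)"
    by (rule filterlim_compose) (rule filterlim_inverse_at_top_right)
  moreover have "eventually (\<lambda>t. (inverse t) ^ m / exp (inverse t) = flat m t) (at_right 0)"
    by (auto simp: eventually_at_filter flat_def exp_minus field_simps)
  ultimately have "(flat m \<longlongrightarrow> 0) (at_right 0)"
    by (rule Lim_transform_eventually)
  moreover have "(flat m \<longlongrightarrow> 0) (at_left 0)"
    by (rule tendsto_eventually) (auto simp: eventually_at_filter flat_def)
  ultimately show ?thesis
    by (simp add: filterlim_split_at)
qed

lemma flat_deriv: "(flat m has_real_derivative (flat (m + 2) t - real m * flat (m + 1) t)) (at t)"
proof -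
  consider "t < 0" | "t = 0" | "t > 0" by linarith
  then show ?thesis
  proof cases
    case 1
    have "(flat m has_real_derivative 0) (at t)"
      by (rule DERIV_cong_ev[THEN iffD1, of t t "\<lambda>_. 0" _ 0, rotated 3])
         (use 1 eventually_nhds_in_open[of "{..<0}" t] in \<open>auto simp: flat_def elim!: eventually_mono\<close>)
    then show ?thesis using 1 by (simp add: flat_def)
  next
    case 2
    have "((\<lambda>h. (flat m (0 + h) - flat m 0) / h) \<longlongrightarrow> 0) (at 0)"
    proof (rule Lim_transform_eventually[OF flat_tendsto_0[of "Suc m"]])
      show "eventually (\<lambda>h. flat (Suc m) h = (flat m (0 + h) - flat m 0) / h) (at 0)"
        by (auto simp: eventually_at_filter flat_def)
    qed
    then show ?thesis using 2 by (simp add: DERIV_def flat_def)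
  next
    case 3
    have "((\<lambda>t. (1 / t) ^ m * exp (- (1 / t))) has_real_derivative
        (flat (m + 2) t - real m * flat (m + 1) t)) (at t)"
    proof -
      define u where "u = 1 / t"
      have D: "((\<lambda>t. 1 / t) has_real_derivative - (u * u)) (at t)"
        using 3 by (auto intro!: derivative_eq_intros simp: u_def)
      have "((\<lambda>t. exp (- (1 / t))) has_real_derivative exp (- u) * (u * u)) (at t)"
        using 3 by (auto intro!: derivative_eq_intros simp: u_def)
      from DERIV_mult[OF DERIV_power[OF D, of m] this]
      have "((\<lambda>t. (1 / t) ^ m * exp (- (1 / t))) has_real_derivative
          real m * (u ^ (m - Suc 0) * - (u * u)) * exp (- u) + exp (- u) * (u * u) * u ^ m) (at t)"
        by (simp add: u_def algebra_simps)
      moreover have "real m * (u ^ (m - Suc 0) * - (u * u)) * exp (- u) + exp (- u) * (u * u) * u ^ m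
          = u ^ (m + 2) * exp (- u) - real m * (u ^ (m + 1) * exp (- u))"
        by (cases m) (simp_all add: algebra_simps power2_eq_square)
      ultimately show ?thesis
        using 3 by (simp add: flat_def u_def)
    qed
    moreover have "eventually (\<lambda>s. (1 / s) ^ m * exp (- (1 / s)) = flat m s) (nhds t)"
      using 3 eventually_nhds_in_open[of "{0<..}" t] by (auto simp: flat_def elim!: eventually_mono)
    ultimately show ?thesis
      using DERIV_cong_ev[of t t "\<lambda>t. (1 / t) ^ m * exp (- (1 / t))" "flat m"] by blast
  qed
qed

lemma Ck_flat: "Ck k (\<lambda>x. flat m (x \<bullet> v + c))"
proof (induction k arbitrary: m)
  case 0
  have "isCont (flat m) t" for t
    using flat_deriv DERIV_isCont by blast
  then have "continuous_on UNIV (flat m)"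
    by (simp add: continuous_at_imp_continuous_on)
  then have "continuous_on UNIV (flat m \<circ> (\<lambda>x. x \<bullet> v + c))"
    by (intro continuous_on_compose continuous_intros) (auto intro: continuous_on_subset)
  then show ?case by (simp add: o_def)
next
  case (Suc k)
  show ?case
  proof (rule Ck_SucI)
    show "((\<lambda>x. flat m (x \<bullet> v + c)) has_derivative
        (\<lambda>h. (flat (m + 2) (x \<bullet> v + c) + (- real m) * flat (m + 1) (x \<bullet> v + c)) * (h \<bullet> v))) (at x)" for x
      by (rule has_derivative_eq_rhs,
          rule has_derivative_compose[OF _ flat_deriv[unfolded has_field_derivative_def]])
         (auto intro!: derivative_eq_intros)
    show "Ck k (\<lambda>x. (flat (m + 2) (x \<bullet> v + c) + (- real m) * flat (m + 1) (x \<bullet> v + c)) * (b \<bullet> v))" for b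
      by (intro Ck_mult Ck_add Ck_const Suc.IH)
  qed
qed

lemma flat_0_bounds: "0 \<le> flat 0 t" "flat 0 t \<le> 1" "flat 0 t = 0 \<longleftrightarrow> t \<le> 0"
  by (auto simp: flat_def)

lemma flat_0_scale_tendsto:
  "(\<lambda>k. flat 0 (real k * t)) \<longlonglongrightarrow> (if t > 0 then 1 else 0 :: real)"
proof (cases "t > 0")
  case True
  have "(\<lambda>k. exp (- (inverse t * inverse (real k)))) \<longlonglongrightarrow> exp (- (inverse t * 0))"
    by (intro tendsto_intros lim_inverse_n)
  moreover have "eventually (\<lambda>k. exp (- (inverse t * inverse (real k))) = flat 0 (real k * t)) sequentially"
    using eventually_gt_at_top[of 0]
    by eventually_elim (use True in \<open>auto simp: flat_def field_simps mult_le_0_iff\<close>)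
  ultimately show ?thesis
    using True by (auto dest: Lim_transform_eventually)
qed (auto simp: flat_def mult_le_0_iff zero_less_mult_iff intro!: tendsto_eventually)

text \<open>Since \<open>exp (- 1 / (k t))\<close> tends to \<open>1\<close> for every \<open>t > 0\<close>, no normalised cut-off function is needed
  to approximate the indicator of a box: it suffices to let the slope \<open>k\<close> grow.\<close>

definition box_bump :: "'a::euclidean_space \<Rightarrow> 'a \<Rightarrow> nat \<Rightarrow> 'a \<Rightarrow> real" where
  "box_bump a c k x = (\<Prod>b\<in>Basis. flat 0 (real k * (x \<bullet> b - a \<bullet> b)) * flat 0 (real k * (c \<bullet> b - x \<bullet> b)))"

lemma Ck_box_bump: "Ck j (box_bump a c k)"
proof -
  have "Ck j (\<lambda>x. flat 0 (x \<bullet> (real k *\<^sub>R b) + (- real k * (a \<bullet> b))) * flat 0 (x \<bullet> (- real k *\<^sub>R b) + real k * (c \<bullet> b)))" for b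
    by (intro Ck_mult Ck_flat)
  then have "Ck j (\<lambda>x. flat 0 (real k * (x \<bullet> b - a \<bullet> b)) * flat 0 (real k * (c \<bullet> b - x \<bullet> b)))" for b
    by (simp add: algebra_simps)
  then show ?thesis
    unfolding box_bump_def by (intro Ck_prod)
qed

lemma box_bump_bounds: "0 \<le> box_bump a c k x" "box_bump a c k x \<le> 1"
  unfolding box_bump_def
  by (auto intro!: prod_nonneg prod_le_1 mult_nonneg_nonneg mult_le_one flat_0_bounds)

lemma box_bump_0: "x \<notin> box a c \<Longrightarrow> box_bump a c k x = 0"
  by (auto simp: box_bump_def mem_box flat_0_bounds mult_le_0_iff not_less)

lemma box_bump_tendsto: "(\<lambda>k. box_bump a c k x) \<longlonglongrightarrow> indicator (box a c) x"
proof -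
  have "(\<lambda>k. box_bump a c k x) \<longlonglongrightarrow>
      (\<Prod>b\<in>Basis. (if x \<bullet> b - a \<bullet> b > 0 then 1 else 0 :: real) * (if c \<bullet> b - x \<bullet> b > 0 then 1 else 0))"
    unfolding box_bump_def by (intro tendsto_prod tendsto_mult flat_0_scale_tendsto)
  moreover have "(\<Prod>b\<in>Basis. (if x \<bullet> b - a \<bullet> b > 0 then 1 else 0 :: real) * (if c \<bullet> b - x \<bullet> b > 0 then 1 else 0))
      = indicator (box a c) x"
    by (auto simp: indicator_def mem_box intro!: prod.neutral)
  ultimately show ?thesis by simp
qed

lemma test_functionI:
  assumes "\<And>k. Ck k \<eta>" "compact K" "K \<subseteq> G" "\<And>x. x \<notin> K \<Longrightarrow> \<eta> x = 0"
  shows "test_function G \<eta>"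
proof -
  have "closure {x. \<eta> x \<noteq> 0} \<subseteq> K"
    using assms by (intro closure_minimal) (auto intro: compact_imp_closed)
  moreover from this have "compact (closure {x. \<eta> x \<noteq> 0})"
    using assms(2) by (metis closed_closure compact_Int_closed inf.absorb_iff2)
  ultimately show ?thesis
    using assms by (auto simp: test_function_def)
qed

lemma test_function_support:
  assumes "test_function G \<eta>"
  shows "\<exists>K. compact K \<and> K \<subseteq> G \<and> (\<forall>x. x \<notin> K \<longrightarrow> \<eta> x = 0)"
  using assms closure_subset[of "{x. \<eta> x \<noteq> 0}"] unfolding test_function_def by blast

lemma test_function_Ck: "test_function G \<eta> \<Longrightarrow> Ck k \<eta>"
  by (auto simp: test_function_def)

lemma test_function_mult:
  assumes "test_function G \<eta>" "\<And>k. Ck k \<phi>"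
  shows "test_function G (\<lambda>x. \<phi> x * \<eta> x)"
proof -
  obtain K where "compact K" "K \<subseteq> G" "\<And>x. x \<notin> K \<Longrightarrow> \<eta> x = 0"
    using test_function_support[OF assms(1)] by blast
  with assms show ?thesis
    by (intro test_functionI[of _ K] Ck_mult) (auto simp: test_function_Ck)
qed

lemma test_function_box_bump: "cbox a c \<subseteq> G \<Longrightarrow> test_function G (box_bump a c k)"
  using box_subset_cbox[of a c]
  by (intro test_functionI[of _ "cbox a c"] Ck_box_bump box_bump_0) auto

lemma test_function_dilate:
  fixes \<eta> :: "'a::euclidean_space \<Rightarrow> real"
  assumes "test_function (- {0}) \<eta>" "s \<noteq> 0"
  shows "test_function (- {0}) (\<lambda>x. \<eta> (s *\<^sub>R x))"
proof -
  obtain K where K: "compact K" "K \<subseteq> - {0}" "\<And>x. x \<notin> K \<Longrightarrow> \<eta> x = 0"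
    using test_function_support[OF assms(1)] by blast 
  show ?thesis
  proof (rule test_functionI[of _ "(\<lambda>x. inverse s *\<^sub>R x) ` K"])
    show "\<eta> (s *\<^sub>R x) = 0" if "x \<notin> (\<lambda>x. inverse s *\<^sub>R x) ` K" for x
    proof (rule K(3))
      show "s *\<^sub>R x \<notin> K"
        using that assms(2) by (auto simp: image_iff dest: bspec[of _ _ "s *\<^sub>R x"])
    qed
  qed (use K assms in \<open>auto intro!: Ck_dilate compact_scaling test_function_Ck[OF assms(1)]\<close>)
qed

lemma grad_derivative:
  fixes f :: "'a::euclidean_space \<Rightarrow> real"
  assumes "(f has_derivative D) (at x)"
  shows "grad f x \<bullet> h = D h"
proof -
  have D: "frechet_derivative f (at x) = D"
    using frechet_derivative_at[OF assms] by simp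
  have lin: "linear D" using assms has_derivative_linear by blast
  have "D h = D (\<Sum>b\<in>Basis. (h \<bullet> b) *\<^sub>R b)" by (simp add: euclidean_representation)
  also have "\<dots> = (\<Sum>b\<in>Basis. (h \<bullet> b) * D b)"
    unfolding linear_sum[OF lin] linear_scale[OF lin] by simp
  also have "\<dots> = grad f x \<bullet> h"
    by (simp add: grad_def D inner_sum_left inner_sum_right inner_commute mult.commute)
  finally show ?thesis ..
qed

lemma grad_eqI:
  fixes f :: "'a::euclidean_space \<Rightarrow> real"
  assumes "(f has_derivative (\<lambda>h. v \<bullet> h)) (at x)"
  shows "grad f x = v"
  using grad_derivative[OF assms] by (metis euclidean_eqI)

lemma test_has_derivative:
  assumes "test_function G \<eta>"
  shows "(\<eta> has_derivative (\<lambda>h. grad \<eta> x \<bullet> h)) (at x)"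
proof -
  have *: "(\<eta> has_derivative frechet_derivative \<eta> (at x)) (at x)"
    by (rule Ck_derivative[OF test_function_Ck[OF assms]])
  show ?thesis using * by (simp add: grad_derivative[OF *])
qed

lemma test_continuous:
  assumes "test_function G \<eta>"
  shows "continuous_on UNIV \<eta>" "continuous_on UNIV (grad \<eta>)"
proof -
  show "continuous_on UNIV \<eta>"
    using test_function_Ck[OF assms, of 0] by simp
  show "continuous_on UNIV (grad \<eta>)"
    unfolding grad_def using test_function_Ck[OF assms, of "Suc 0"]
    by (auto intro!: continuous_intros)
qed

lemma has_derivative_vanishing:
  fixes f :: "'a::euclidean_space \<Rightarrow> real"
  assumes "closed K" "\<And>x. x \<notin> K \<Longrightarrow> f x = 0" "x \<notin> K"
  shows "(f has_derivative (\<lambda>h. 0)) (at x)"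
  by (rule has_derivative_transform_within_open[of "\<lambda>_. 0" _ _ UNIV "- K"])
     (use assms in \<open>auto simp: open_Compl\<close>)

lemma grad_vanishing:
  fixes f :: "'a::euclidean_space \<Rightarrow> real"
  assumes "closed K" "\<And>x. x \<notin> K \<Longrightarrow> f x = 0" "x \<notin> K"
  shows "grad f x = 0"
  using has_derivative_vanishing[OF assms] by (intro grad_eqI) simp

section \<open>Integration by parts\<close>

lemma lborel_integral_translate:
  fixes f :: "'a::euclidean_space \<Rightarrow> real"
  assumes [measurable]: "f \<in> borel_measurable borel"
  shows "(LINT x|lborel. f (c + x)) = (LINT x|lborel. f x)"
proof -
  have "(LINT x|lborel. f x) = (LINT x|distr lborel borel ((+) c). f x)"
    by (simp add: lborel_distr_plus)
  also have "\<dots> = (LINT x|lborel. f (c + x))"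
    by (rule integral_distr) auto
  finally show ?thesis ..
qed

lemma continuous_vanishing_bound:
  fixes F :: "'a::euclidean_space \<Rightarrow> real"
  assumes "continuous_on UNIV F" "compact K" "\<And>x. x \<notin> K \<Longrightarrow> F x = 0"
  shows "\<exists>B\<ge>0. \<forall>x. \<bar>F x\<bar> \<le> B"
proof -
  have "compact (F ` K)"
    using assms by (intro compact_continuous_image) (auto intro: continuous_on_subset)
  then obtain B where "B > 0" "\<forall>y\<in>F ` K. norm y \<le> B"
    using compact_imp_bounded bounded_pos by blast
  with assms(3) show ?thesis
    by (intro exI[of _ B]) (metis abs_zero image_eqI less_imp_le real_norm_def)
qed

text \<open>The difference quotients of \<open>f\<close> in the direction \<open>v\<close> have integral zero because Lebesgue measure is
  invariant under translations. They are uniformly bounded with a common compact support, so their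
  limit has integral zero too.\<close>

lemma integral_derivative_zero:
  fixes f :: "'a::euclidean_space \<Rightarrow> real"
  assumes d: "\<And>x. (f has_derivative (\<lambda>h. F x \<bullet> h)) (at x)"
    and F: "continuous_on UNIV F" and K: "compact K" "\<And>x. x \<notin> K \<Longrightarrow> f x = 0"
  shows "(LINT x|lborel. F x \<bullet> v) = 0"
proof -
  have cf: "continuous_on UNIV f"
    using d by (meson differentiableI differentiable_imp_continuous_on differentiable_on_def differentiable_at_withinI)
  have [measurable]: "f \<in> borel_measurable borel" "F \<in> borel_measurable borel"
    using cf F by (auto intro: borel_measurable_continuous_onI)
  have F0: "F x = 0" if "x \<notin> K" for x
    using has_derivative_unique[OF d has_derivative_vanishing[OF compact_imp_closed[OF K(1)] K(2) that]]
    by (metis inner_eq_zero_iff)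
  have "\<exists>B\<ge>0. \<forall>x. \<bar>F x \<bullet> v\<bar> \<le> B"
    using F0 F K(1) by (intro continuous_vanishing_bound[of _ K] continuous_intros) auto
  then obtain B where B: "B \<ge> 0" "\<And>x. \<bar>F x \<bullet> v\<bar> \<le> B" by auto
  have lip: "\<bar>f (h *\<^sub>R v + x) - f x\<bar> \<le> B * h" if hp: "h > 0" for x h
  proof -
    have "((\<lambda>s. f (s *\<^sub>R v + x)) has_real_derivative F (s *\<^sub>R v + x) \<bullet> v) (at s)" for s
      unfolding has_field_derivative_def
      by (rule has_derivative_eq_rhs, rule has_derivative_compose[OF _ d])
         (auto intro!: derivative_eq_intros simp: mult.commute)
    then obtain z where "f (h *\<^sub>R v + x) - f (0 *\<^sub>R v + x) = (h - 0) * (F (z *\<^sub>R v + x) \<bullet> v)"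
      using MVT2[OF hp, of "\<lambda>s. f (s *\<^sub>R v + x)" "\<lambda>s. F (s *\<^sub>R v + x) \<bullet> v"] by auto
    then show ?thesis using B(2)[of "z *\<^sub>R v + x"] that
      by (simp add: abs_mult mult.commute)
  qed
  obtain R where R: "\<And>x. x \<in> K \<Longrightarrow> norm x \<le> R"
    using compact_imp_bounded[OF K(1)] bounded_iff by metis
  define h where "h k = inverse (real (Suc k))" for k
  have h: "h k > 0" "h k \<le> 1" for k
    by (auto simp: h_def field_simps)
  have h0: "h \<longlonglongrightarrow> 0"
    unfolding h_def by (rule LIMSEQ_inverse_real_of_nat)
  have integ: "integrable lborel f"
  proof -
    have "integrable lborel (\<lambda>x. indicator K x *\<^sub>R f x)"
      using K cf by (intro borel_integrable_compact) (auto intro: continuous_on_subset)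
    moreover have "(\<lambda>x. indicator K x *\<^sub>R f x) = f"
      using K(2) by (auto simp: fun_eq_iff indicator_def)
    ultimately show ?thesis by simp
  qed
  have integ2: "integrable lborel (\<lambda>x. f (c + x))" for c
  proof -
    have "integrable (distr lborel borel ((+) c)) f"
      using integ by (simp add: lborel_distr_plus)
    then show ?thesis by (subst (asm) integrable_distr_eq) auto
  qed
  define s where "s k x = (f (h k *\<^sub>R v + x) - f x) / h k" for k x
  have "(\<lambda>k. LINT x|lborel. s k x) \<longlonglongrightarrow> (LINT x|lborel. F x \<bullet> v)"
  proof (rule integral_dominated_convergence)
    show "integrable lborel (\<lambda>x. B * indicator (cball 0 (R + norm v)) x)"
      by (intro integrable_mult_right integrable_real_indicator)
         (use emeasure_compact_finite[OF compact_cball, of 0 "R + norm v"] in auto)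
    show "AE x in lborel. (\<lambda>k. s k x) \<longlonglongrightarrow> F x \<bullet> v"
    proof (intro AE_I2)
      fix x
      have "((\<lambda>s. f (s *\<^sub>R v + x)) has_real_derivative F (0 *\<^sub>R v + x) \<bullet> v) (at 0)"
        unfolding has_field_derivative_def
        by (rule has_derivative_eq_rhs, rule has_derivative_compose[OF _ d])
           (auto intro!: derivative_eq_intros simp: mult.commute)
      then have "((\<lambda>t. (f (t *\<^sub>R v + x) - f x) / t) \<longlongrightarrow> F x \<bullet> v) (at 0)"
        by (simp add: DERIV_def)
      then show "(\<lambda>k. s k x) \<longlonglongrightarrow> F x \<bullet> v"
        unfolding s_def using h h0
        by (auto intro!: filterlim_compose[of "\<lambda>t. (f (t *\<^sub>R v + x) - f x) / t" _ "at 0" h]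
            simp: filterlim_at less_imp_neq[THEN not_sym])
    qed
    show "AE x in lborel. norm (s k x) \<le> B * indicator (cball 0 (R + norm v)) x" for k
    proof (intro AE_I2)
      fix x
      show "norm (s k x) \<le> B * indicator (cball 0 (R + norm v)) x"
      proof (cases "x \<in> cball 0 (R + norm v)")
        case True
        then show ?thesis using lip[OF h(1), of k x] h(1)[of k] by (simp add: s_def field_simps)
      next
        case False
        then have "norm x > R + norm v" by simp
        moreover have "norm (h k *\<^sub>R v) \<le> norm v" using h[of k] by (simp add: mult_left_le_one_le)
        moreover have "norm (h k *\<^sub>R v + x) \<ge> norm x - norm (h k *\<^sub>R v)"
          by (metis add.commute norm_diff_ineq)
        moreover have "norm v \<ge> 0" by simp
        ultimately have "f x = 0" "f (h k *\<^sub>R v + x) = 0"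
          using R[of x] R[of "h k *\<^sub>R v + x"] K(2) by fastforce+
        then show ?thesis using False by (simp add: s_def)
      qed
    qed
  qed (auto simp: s_def)
  moreover have "(LINT x|lborel. s k x) = 0" for k
    using integ integ2 by (simp add: s_def lborel_integral_translate)
  ultimately show ?thesis
    by (simp only: LIMSEQ_const_iff)
qed

section \<open>Local integrability\<close>

definition loc_int :: "'a::euclidean_space set \<Rightarrow> ('a \<Rightarrow> 'b::euclidean_space) \<Rightarrow> bool" where
  "loc_int G f \<longleftrightarrow> f \<in> borel_measurable (lebesgue_on G) \<and>
     (\<forall>K. compact K \<and> K \<subseteq> G \<longrightarrow> integrable (lebesgue_on K) f)"

lemma sets_lebesgue_open: "open G \<Longrightarrow> G \<in> sets lebesgue"
  and sets_lebesgue_compact: "compact K \<Longrightarrow> K \<in> sets lebesgue"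
  by (metis borel_open borel_compact sets_completionI_sets sets_lborel)+

lemma loc_int_indicator:
  assumes "loc_int G f" "compact K" "K \<subseteq> G"
  shows "integrable lebesgue (\<lambda>x. indicator K x *\<^sub>R f x)"
  using assms by (auto simp: loc_int_def integrable_restrict_space sets_lebesgue_compact)

lemma loc_int_bound:
  assumes "loc_int G f" "open G" "h \<in> borel_measurable (lebesgue_on G)"
    and "\<And>x. x \<in> G \<Longrightarrow> norm (h x) \<le> norm (f x)"
  shows "loc_int G h"
  unfolding loc_int_def
proof (intro conjI allI impI)
  fix K assume K: "compact K \<and> K \<subseteq> G"
  show "integrable (lebesgue_on K) h"
  proof (rule Bochner_Integration.integrable_bound)
    show "integrable (lebesgue_on K) f" using assms(1) K by (auto simp: loc_int_def)
    show "h \<in> borel_measurable (lebesgue_on K)"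
      using assms K by (meson measurable_restrict_mono)
    show "AE x in lebesgue_on K. norm (h x) \<le> norm (f x)"
      using K assms by (intro AE_I2) (auto simp: space_restrict_space)
  qed
qed (use assms in auto)

lemma continuous_measurable_lebesgue:
  "continuous_on UNIV f \<Longrightarrow> f \<in> borel_measurable lebesgue"
  for f :: "'a::euclidean_space \<Rightarrow> 'b::euclidean_space"
  by (intro measurable_completion) (simp add: borel_measurable_continuous_onI)

lemma loc_int_continuous:
  assumes "open G" "continuous_on G f"
  shows "loc_int G f"
  unfolding loc_int_def
proof (intro conjI allI impI)
  show "f \<in> borel_measurable (lebesgue_on G)"
    using assms by (intro continuous_imp_measurable_on_sets_lebesgue sets_lebesgue_open)
  fix K assume K: "compact K \<and> K \<subseteq> G"
  then have *: "integrable lborel (\<lambda>x. indicator K x *\<^sub>R f x)"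
    using assms by (intro borel_integrable_compact) (auto intro: continuous_on_subset)
  then have "integrable lebesgue (\<lambda>x. indicator K x *\<^sub>R f x)"
    by (subst integrable_completion) auto
  then show "integrable (lebesgue_on K) f"
    using K by (subst integrable_restrict_space) (auto simp: sets_lebesgue_compact)
qed

lemma loc_int_diff: "loc_int G f \<Longrightarrow> loc_int G g \<Longrightarrow> loc_int G (\<lambda>x. f x - g x)"
  by (auto simp: loc_int_def)

lemma loc_int_scaleR_continuous:
  assumes "loc_int G f" "open G" "continuous_on G \<phi>"
  shows "loc_int G (\<lambda>x. \<phi> x *\<^sub>R f x)"
  unfolding loc_int_def
proof (intro conjI allI impI)
  have [measurable]: "\<phi> \<in> borel_measurable (lebesgue_on G)" "f \<in> borel_measurable (lebesgue_on G)"
    using assms by (auto simp: loc_int_def intro: continuous_imp_measurable_on_sets_lebesgue sets_lebesgue_open)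
  show m: "(\<lambda>x. \<phi> x *\<^sub>R f x) \<in> borel_measurable (lebesgue_on G)" by measurable
  fix K assume K: "compact K \<and> K \<subseteq> G"
  have "compact (\<phi> ` K)"
    using assms K by (intro compact_continuous_image) (auto intro: continuous_on_subset)
  then obtain B where B: "B > 0" "\<forall>y\<in>\<phi> ` K. norm y \<le> B"
    using compact_imp_bounded bounded_pos by blast
  show "integrable (lebesgue_on K) (\<lambda>x. \<phi> x *\<^sub>R f x)"
  proof (rule Bochner_Integration.integrable_bound)
    show "integrable (lebesgue_on K) (\<lambda>x. B *\<^sub>R f x)" using assms(1) K by (auto simp: loc_int_def)
    show "(\<lambda>x. \<phi> x *\<^sub>R f x) \<in> borel_measurable (lebesgue_on K)"
      using m K by (meson measurable_restrict_mono)
    show "AE x in lebesgue_on K. norm (\<phi> x *\<^sub>R f x) \<le> norm (B *\<^sub>R f x)"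
      using B by (intro AE_I2) (auto simp: space_restrict_space intro!: mult_right_mono)
  qed
qed

lemma loc_int_mult_continuous:
  fixes f :: "'a::euclidean_space \<Rightarrow> real"
  assumes "loc_int G f" "open G" "continuous_on G \<phi>"
  shows "loc_int G (\<lambda>x. f x * \<phi> x)"
  using loc_int_scaleR_continuous[OF assms] by (simp add: mult.commute)

lemma loc_int_inner_continuous:
  assumes "loc_int G f" "open G" "continuous_on G g"
  shows "loc_int G (\<lambda>x. f x \<bullet> g x)"
proof (rule loc_int_bound[OF loc_int_scaleR_continuous[OF assms(1,2)], of "\<lambda>x. norm (g x)"])
  have [measurable]: "g \<in> borel_measurable (lebesgue_on G)" "f \<in> borel_measurable (lebesgue_on G)"
    using assms by (auto simp: loc_int_def intro: continuous_imp_measurable_on_sets_lebesgue sets_lebesgue_open)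
  show "(\<lambda>x. f x \<bullet> g x) \<in> borel_measurable (lebesgue_on G)" by measurable
qed (use assms in \<open>auto intro!: continuous_intros simp: mult.commute Cauchy_Schwarz_ineq2\<close>)

lemma vanishing_integral_eq:
  fixes h :: "'a::euclidean_space \<Rightarrow> 'b::euclidean_space"
  assumes "G \<in> sets lebesgue" "K \<subseteq> G" "\<And>x. x \<notin> K \<Longrightarrow> h x = 0"
  shows "(LINT x|lebesgue_on G. h x) = (LINT x|lebesgue. h x)"
proof -
  have "(\<lambda>x. indicator G x *\<^sub>R h x) = h"
    using assms by (auto simp: fun_eq_iff indicator_def)
  then show ?thesis using assms(1) by (simp add: integral_restrict_space)
qed

lemma loc_int_vanishing_integrable:
  fixes h :: "'a::euclidean_space \<Rightarrow> 'b::euclidean_space"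
  assumes "loc_int G h" "open G" "compact K" "K \<subseteq> G" "\<And>x. x \<notin> K \<Longrightarrow> h x = 0"
  shows "integrable lebesgue h" "integrable (lebesgue_on G) h"
proof -
  have "(\<lambda>x. indicator K x *\<^sub>R h x) = h"
    using assms by (auto simp: fun_eq_iff indicator_def)
  with loc_int_indicator[OF assms(1,3,4)] show *: "integrable lebesgue h" by simp
  have "(\<lambda>x. indicator G x *\<^sub>R h x) = h"
    using assms by (auto simp: fun_eq_iff indicator_def)
  with * show "integrable (lebesgue_on G) h"
    using assms(2) by (simp add: integrable_restrict_space sets_lebesgue_open)
qed

lemma test_integrable:
  fixes f :: "'a::euclidean_space \<Rightarrow> real"
  assumes "loc_int G f" "open G" "test_function G \<eta>"
  shows "integrable (lebesgue_on G) (\<lambda>x. f x * \<eta> x)"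
proof -
  obtain K where K: "compact K" "K \<subseteq> G" "\<And>x. x \<notin> K \<Longrightarrow> \<eta> x = 0"
    using test_function_support[OF assms(3)] by blast
  show ?thesis
    using K assms test_continuous[OF assms(3)]
    by (intro loc_int_vanishing_integrable(2)[OF _ _ K(1)] loc_int_mult_continuous)
       (auto intro: continuous_on_subset)
qed

lemma test_grad_integrable:
  assumes "loc_int G f" "open G" "test_function G \<eta>"
  shows "integrable (lebesgue_on G) (\<lambda>x. f x \<bullet> grad \<eta> x)"
proof -
  obtain K where K: "compact K" "K \<subseteq> G" "\<And>x. x \<notin> K \<Longrightarrow> \<eta> x = 0"
    using test_function_support[OF assms(3)] by blast
  have "grad \<eta> x = 0" if "x \<notin> K" for x
    using grad_vanishing[of K \<eta> x] compact_imp_closed[OF K(1)] K(3) that by blast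
  then show ?thesis
    using K assms test_continuous[OF assms(3)]
    by (intro loc_int_vanishing_integrable(2)[OF _ _ K(1)] loc_int_inner_continuous)
       (auto intro: continuous_on_subset)
qed

text \<open>The function \<open>k\<close> may be irregular outside \<open>G\<close>. The product \<open>k \<eta>\<close> vanishes there, so it is
  continuously differentiable on the whole space.\<close>

lemma integration_by_parts:
  fixes k :: "'a::euclidean_space \<Rightarrow> real"
  assumes G: "open G" and t: "test_function G \<eta>"
    and d: "\<And>x. x \<in> G \<Longrightarrow> (k has_derivative (\<lambda>h. F x \<bullet> h)) (at x)"
    and F: "continuous_on G F"
  shows "(LINT x|lebesgue_on G. k x * (grad \<eta> x \<bullet> v)) = - (LINT x|lebesgue_on G. \<eta> x * (F x \<bullet> v))"
proof -
  obtain K where K: "compact K" "K \<subseteq> G" "\<And>x. x \<notin> K \<Longrightarrow> \<eta> x = 0"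
    using test_function_support[OF t] by blast
  have g0: "grad \<eta> x = 0" if "x \<notin> K" for x
    using grad_vanishing[of K \<eta> x] compact_imp_closed[OF K(1)] K(3) that by blast
  have ck: "continuous_on G k"
    using d by (meson continuous_at_imp_continuous_on has_derivative_continuous)
  have vanish: "continuous_on UNIV (\<lambda>x. f x)" if "continuous_on G f" "\<And>x. x \<notin> K \<Longrightarrow> f x = 0" 
    for f :: "'a \<Rightarrow> 'a"
  proof -
    have "continuous_on (G \<union> - K) f"
    proof (rule continuous_on_open_Un)
      show "continuous_on (- K) f"
        using that(2) continuous_on_cong[of "- K" "- K" f "\<lambda>_. 0"] by auto
    qed (use K G that in \<open>auto intro: compact_imp_closed\<close>)
    moreover have "G \<union> - K = UNIV" using K by auto
    ultimately show ?thesis by simp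
  qed
  define D where "D x = k x *\<^sub>R grad \<eta> x + \<eta> x *\<^sub>R F x" for x
  have "(LINT x|lborel. D x \<bullet> v) = 0"
  proof (rule integral_derivative_zero[OF _ _ K(1)])
    show "((\<lambda>x. k x * \<eta> x) has_derivative (\<lambda>h. D x \<bullet> h)) (at x)" for x
    proof (cases "x \<in> K")
      case True
      with K(2) have "x \<in> G" by auto
      from has_derivative_mult[OF d[OF this] test_has_derivative[OF t]]
      show ?thesis by (simp add: D_def inner_add_left mult.commute)
    next
      case False
      have "((\<lambda>x. k x * \<eta> x) has_derivative (\<lambda>h. 0)) (at x)"
        using K False by (intro has_derivative_vanishing[of K]) (auto intro: compact_imp_closed)
      then show ?thesis using False by (simp add: D_def g0 K(3))
    qed
    have "continuous_on G D"
      unfolding D_def using ck F test_continuous[OF t]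
      by (intro continuous_intros) (auto intro: continuous_on_subset)
    then show "continuous_on UNIV D"
      using vanish[of D] by (simp add: D_def g0 K(3))
  qed (use K in auto)
  moreover have mD: "(\<lambda>x. D x \<bullet> v) \<in> borel_measurable borel"
  proof -
    have "continuous_on G D"
      unfolding D_def using ck F test_continuous[OF t]
      by (intro continuous_intros) (auto intro: continuous_on_subset)
    then have "continuous_on UNIV D"
      using vanish[of D] by (simp add: D_def g0 K(3))
    then show ?thesis by (intro borel_measurable_continuous_onI continuous_intros)
  qed
  ultimately have "(LINT x|lebesgue. D x \<bullet> v) = 0"
    by (simp add: integral_completion)
  then have "(LINT x|lebesgue_on G. D x \<bullet> v) = 0"
    using K G by (subst vanishing_integral_eq[of _ K]) (auto simp: D_def g0 intro: sets_lebesgue_open)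
  moreover have "(LINT x|lebesgue_on G. D x \<bullet> v)
      = (LINT x|lebesgue_on G. k x * (grad \<eta> x \<bullet> v)) + (LINT x|lebesgue_on G. \<eta> x * (F x \<bullet> v))"
  proof -
    have "integrable (lebesgue_on G) (\<lambda>x. k x * (grad \<eta> x \<bullet> v))"
      using K G g0 ck test_continuous[OF t]
      by (intro loc_int_vanishing_integrable(2)[OF _ _ K(1)] loc_int_continuous continuous_intros)
         (auto intro: continuous_on_subset)
    moreover have "integrable (lebesgue_on G) (\<lambda>x. \<eta> x * (F x \<bullet> v))"
      using K G F test_continuous[OF t]
      by (intro loc_int_vanishing_integrable(2)[OF _ _ K(1)] loc_int_continuous continuous_intros)
         (auto intro: continuous_on_subset)
    ultimately show ?thesis by (simp add: D_def inner_add_left)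
  qed
  ultimately show ?thesis by simp
qed

section \<open>The fundamental lemma\<close>

lemma box_integral_zero:
  fixes f :: "'a::euclidean_space \<Rightarrow> real"
  assumes f: "loc_int G f" and G: "open G"
    and z: "\<And>\<eta>. test_function G \<eta> \<Longrightarrow> (LINT x|lebesgue_on G. f x * \<eta> x) = 0"
    and sub: "cbox a c \<subseteq> G"
  shows "(LINT x|lebesgue. indicator (box a c) x * f x) = 0"
proof -
  have i: "integrable lebesgue (\<lambda>x. indicator (cbox a c) x * f x)"
    using loc_int_indicator[OF f compact_cbox sub] by simp
  have bm: "box_bump a c k \<in> borel_measurable lebesgue" for k
    using Ck_box_bump[of 0 a c k] by (intro continuous_measurable_lebesgue) simp
  have eq: "f x * box_bump a c k x = (indicator (cbox a c) x * f x) * box_bump a c k x" for k x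
    using box_bump_0[of x a c k] box_subset_cbox[of a c] by (auto simp: indicator_def)
  have eq2: "indicator (box a c) x * f x = (indicator (cbox a c) x * f x) * indicator (box a c) x" for x
    using box_subset_cbox[of a c] by (auto simp: indicator_def)
  have "(\<lambda>k. LINT x|lebesgue. f x * box_bump a c k x) \<longlonglongrightarrow> (LINT x|lebesgue. indicator (box a c) x * f x)"
  proof (rule integral_dominated_convergence)
    show "integrable lebesgue (\<lambda>x. \<bar>indicator (cbox a c) x * f x\<bar>)" using i by simp
    show "AE x in lebesgue. (\<lambda>k. f x * box_bump a c k x) \<longlonglongrightarrow> indicator (box a c) x * f x"
    proof (intro AE_I2)
      fix x
      have "(\<lambda>k. f x * box_bump a c k x) \<longlonglongrightarrow> f x * indicator (box a c) x"
        by (intro tendsto_intros box_bump_tendsto)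
      then show "(\<lambda>k. f x * box_bump a c k x) \<longlonglongrightarrow> indicator (box a c) x * f x"
        by (simp add: mult.commute)
    qed
    show "AE x in lebesgue. norm (f x * box_bump a c k x) \<le> \<bar>indicator (cbox a c) x * f x\<bar>" for k
      unfolding eq using box_bump_bounds[of a c k]
      by (intro AE_I2) (auto simp: abs_mult intro!: mult_left_le)
    show "(\<lambda>x. f x * box_bump a c k x) \<in> borel_measurable lebesgue" for k
      unfolding eq by (rule borel_measurable_times[OF borel_measurable_integrable[OF i] bm])
    show "(\<lambda>x. indicator (box a c) x * f x) \<in> borel_measurable lebesgue"
      unfolding eq2
      by (rule borel_measurable_times[OF borel_measurable_integrable[OF i] borel_measurable_indicator]) auto
  qed
  moreover have "(LINT x|lebesgue. f x * box_bump a c k x) = 0" for k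
  proof -
    have "(LINT x|lebesgue. f x * box_bump a c k x) = (LINT x|lebesgue_on G. f x * box_bump a c k x)"
      using sub box_subset_cbox[of a c] G
      by (intro vanishing_integral_eq[of _ "box a c", symmetric]) (auto simp: box_bump_0 sets_lebesgue_open)
    then show ?thesis using z[OF test_function_box_bump[OF sub]] by simp
  qed
  ultimately show ?thesis
    by (simp only: LIMSEQ_const_iff)
qed

text \<open>Boxes form an intersection-stable generator of the Borel sets, and the sets over which \<open>F\<close> has
  integral zero form a Dynkin system; the hypothesis on the total integral provides the closure under
  complements.\<close>

lemma AE_zero_if_box_integrals_zero:
  fixes F :: "'a::euclidean_space \<Rightarrow> real"
  assumes F: "integrable lebesgue F"
    and z: "\<And>a c. (LINT x|lebesgue. indicator (box a c) x * F x) = 0"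
    and total: "(LINT x|lebesgue. F x) = 0"
  shows "AE x in lebesgue. F x = 0"
proof -
  have si: "set_integrable lebesgue A F" if "A \<in> sets lebesgue" for A
    using integrable_mult_indicator[OF that F] by (simp add: set_integrable_def)
  let ?E = "range (\<lambda>(a, c). box a c :: 'a set)"
  have B: "set_lebesgue_integral lebesgue A F = 0" if "A \<in> sets borel" for A
  proof -
    have stable: "Int_stable ?E" by (auto simp: Int_stable_def box_Int_box)
    have Pow: "?E \<subseteq> Pow UNIV" by auto
    have gen: "sets borel = sigma_sets UNIV ?E" by (simp add: borel_eq_box)
    with that have "A \<in> sigma_sets UNIV ?E" by simp
    with stable Pow show ?thesis
    proof (induction rule: sigma_sets_induct_disjoint)
      case (basic A)
      then show ?case using z by (auto simp: set_lebesgue_integral_def)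
    next
      case (compl A)
      then have A: "A \<in> sets lebesgue" using gen by auto
      have "set_lebesgue_integral lebesgue (A \<union> (UNIV - A)) F
          = set_lebesgue_integral lebesgue A F + set_lebesgue_integral lebesgue (UNIV - A) F"
        using A by (intro set_integral_Un si) auto
      with compl total show ?case by (simp add: set_lebesgue_integral_def)
    next
      case (union A)
      then have "A i \<in> sets borel" for i using gen by blast
      then have A: "A i \<in> sets lebesgue" for i by simp
      have "set_lebesgue_integral lebesgue (\<Union>i. A i) F = (\<Sum>i. set_lebesgue_integral lebesgue (A i) F)"
        using union(1) A by (intro lebesgue_integral_countable_add si) (auto simp: disjoint_family_on_def)
      with union show ?case by simp
    qed (simp add: set_lebesgue_integral_def)
  qed
  have "set_lebesgue_integral lebesgue A F = 0" if "A \<in> sets lebesgue" for A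
  proof -
    from that obtain S N N' where A: "A = S \<union> N" "N \<subseteq> N'" "N' \<in> null_sets lborel" "S \<in> sets lborel"
      by (rule sets_completionE)
    have ae: "AE x in lebesgue. x \<notin> N'"
      using A(3) by (intro AE_not_in null_sets_completionI)
    have "set_lebesgue_integral lebesgue A F = set_lebesgue_integral lebesgue S F"
      unfolding set_lebesgue_integral_def
    proof (rule integral_cong_AE)
      show "AE x in lebesgue. indicat_real A x *\<^sub>R F x = indicat_real S x *\<^sub>R F x"
        using ae by eventually_elim (use A in \<open>auto simp: indicator_def\<close>)
    qed (use si[of A] si[of S] A(4) that in \<open>auto simp: set_integrable_def intro: borel_measurable_integrable\<close>)
    then show ?thesis using B A by simp
  qed
  then show ?thesis
    using density_unique_real[OF F integrable_zero] by (simp add: set_lebesgue_integral_def)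
qed

text \<open>Bumps that tend to the indicator of a box turn the hypothesis into vanishing integrals over all
  boxes inside \<open>G\<close>. On each such box this forces \<open>f\<close> to vanish up to a null set, and countably many of them
  cover \<open>G\<close>.\<close>

theorem fundamental_lemma:
  fixes f :: "'a::euclidean_space \<Rightarrow> real"
  assumes f: "loc_int G f" and G: "open G"
    and z: "\<And>\<eta>. test_function G \<eta> \<Longrightarrow> (LINT x|lebesgue_on G. f x * \<eta> x) = 0"
  shows "AE x in lebesgue_on G. f x = 0"
proof -
  have local: "AE x in lebesgue. x \<in> cbox a c \<longrightarrow> f x = 0" if sub: "cbox a c \<subseteq> G" for a c
  proof -
    define F where "F x = indicator (box a c) x * f x" for x
    have zF: "(LINT x|lebesgue. F x) = 0"
      unfolding F_def by (rule box_integral_zero[OF f G z sub])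
    have "integrable lebesgue (\<lambda>x. indicator (cbox a c) x * f x)"
      using loc_int_indicator[OF f compact_cbox sub] by simp
    then have "integrable lebesgue (\<lambda>x. indicator (box a c) x *\<^sub>R (indicator (cbox a c) x * f x))"
      by (intro integrable_mult_indicator) auto
    moreover have "indicator (box a c) x *\<^sub>R (indicator (cbox a c) x * f x) = F x" for x
      using box_subset_cbox[of a c] by (auto simp: F_def indicator_def)
    ultimately have iF: "integrable lebesgue F" by simp
    \<comment> \<open>An arbitrary box meets the given one in a box that again lies inside \<open>G\<close>.\<close>
    have bF: "(LINT x|lebesgue. indicator (box l u) x * F x) = 0" for l u
    proof -
      obtain m M where mM: "box l u \<inter> box a c = box m M"
        using box_Int_box by blast
      have eq: "indicator (box l u) x * F x = indicator (box m M) x * f x" for x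
        using mM by (auto simp: F_def indicator_def)
      show ?thesis
      proof (cases "box m M = {}")
        case False
        have "cbox m M = closure (box m M)" using False by simp
        also have "\<dots> \<subseteq> cbox a c"
          using mM box_subset_cbox[of a c] by (intro closure_minimal) auto
        finally show ?thesis
          unfolding eq using sub by (intro box_integral_zero[OF f G z]) auto
      qed (simp add: eq)
    qed
    have "AE x in lebesgue. F x = 0"
      using iF bF zF by (rule AE_zero_if_box_integrals_zero)
    moreover have "AE x in lebesgue. x \<notin> cbox a c - box a c"
      using negligible_frontier_interval[of a c] by (intro AE_not_in) (simp add: negligible_iff_null_sets)
    ultimately show ?thesis
      by eventually_elim (auto simp: F_def indicator_def split: if_splits)
  qed
  obtain \<D> where D: "countable \<D>" "\<D> \<subseteq> Pow G" "\<And>X. X \<in> \<D> \<Longrightarrow> \<exists>a b. X = cbox a b" "\<Union>\<D> = G"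
    using open_countable_Union_open_cbox[OF G] by metis
  have "AE x in lebesgue. \<forall>X\<in>\<D>. x \<in> X \<longrightarrow> f x = 0"
    unfolding AE_ball_countable[OF D(1)]
  proof
    fix X assume X: "X \<in> \<D>"
    with D(3) obtain a c where "X = cbox a c" by blast
    then show "AE x in lebesgue. x \<in> X \<longrightarrow> f x = 0"
      using local[of a c] X D(2) by blast
  qed
  then have "AE x in lebesgue. x \<in> G \<longrightarrow> f x = 0"
    by eventually_elim (use D(4) in auto)
  then show ?thesis
    using G by (subst AE_restrict_space_iff) (auto simp: sets_lebesgue_open)
qed

section \<open>Lebesgue measure under dilations\<close>

lemma
  fixes s :: real
  assumes "s \<noteq> 0"
  shows measurable_scale_lebesgue: "(\<lambda>x::'a::euclidean_space. s *\<^sub>R x) \<in> lebesgue \<rightarrow>\<^sub>M lebesgue"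
    and lebesgue_scale: "(lebesgue :: 'a measure) = density (distr lebesgue lebesgue (\<lambda>x. s *\<^sub>R x)) (\<lambda>_. \<bar>s\<bar> ^ DIM('a))"
  using lebesgue_affine_euclidean[of "\<lambda>_. s" "0::'a"] lebesgue_measurable_scaling[of s] assms
  unfolding scaleR_scaleR[symmetric] scaleR_sum_right[symmetric] euclidean_representation by auto

lemma integral_scale:
  fixes h :: "'a::euclidean_space \<Rightarrow> real"
  assumes [measurable]: "h \<in> borel_measurable lebesgue" and s: "s \<noteq> 0"
  shows "(LINT x|lebesgue. h x) = \<bar>s\<bar> ^ DIM('a) * (LINT x|lebesgue. h (s *\<^sub>R x))"
proof -
  note [measurable] = measurable_scale_lebesgue[OF s, where 'a='a]
  show ?thesis
    by (subst lebesgue_scale[OF s]) (simp add: integral_density integral_distr)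
qed

lemma integrable_scale:
  fixes h :: "'a::euclidean_space \<Rightarrow> 'b::euclidean_space"
  assumes "integrable lebesgue h" and s: "s \<noteq> 0"
  shows "integrable lebesgue (\<lambda>x. h (s *\<^sub>R x))"
proof -
  note [measurable] = measurable_scale_lebesgue[OF s, where 'a='a]
  have [measurable]: "h \<in> borel_measurable lebesgue" using assms by auto
  have "integrable (density (distr lebesgue lebesgue (\<lambda>x. s *\<^sub>R x)) (\<lambda>_. \<bar>s\<bar> ^ DIM('a))) h"
    using assms(1) by (subst lebesgue_scale[OF s, symmetric])
  then have "integrable lebesgue (\<lambda>x. \<bar>s\<bar> ^ DIM('a) *\<^sub>R h (s *\<^sub>R x))"
    by (subst (asm) integrable_density) (auto simp: integrable_distr_eq)
  then have "integrable lebesgue (\<lambda>x. (1 / \<bar>s\<bar> ^ DIM('a)) *\<^sub>R (\<bar>s\<bar> ^ DIM('a) *\<^sub>R h (s *\<^sub>R x)))"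
    by (rule integrable_scaleR_right)
  then show ?thesis using s by simp
qed

lemma AE_scale:
  assumes "AE x in (lebesgue :: 'a::euclidean_space measure). P x" and s: "s \<noteq> 0"
  shows "AE x in (lebesgue :: 'a measure). P (s *\<^sub>R x)"
proof -
  note [measurable] = measurable_scale_lebesgue[OF s, where 'a='a]
  have "AE x in density (distr lebesgue lebesgue (\<lambda>x. s *\<^sub>R x)) (\<lambda>_. \<bar>s\<bar> ^ DIM('a)). (P x :: bool)"
    using assms(1) by (subst lebesgue_scale[OF s, symmetric])
  then have "AE x in distr lebesgue lebesgue (\<lambda>x :: 'a. s *\<^sub>R x). P x"
    using s by (subst (asm) AE_density) auto
  then show ?thesis
    by (rule AE_distrD[OF measurable_scale_lebesgue[OF s]])
qed

section \<open>Weak gradients\<close>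

definition flux :: "real \<Rightarrow> 'a::euclidean_space \<Rightarrow> 'a" where
  "flux p v = norm v powr (p - 2) *\<^sub>R v"

lemma norm_flux: "norm (flux p v) = norm v powr (p - 1)"
  by (cases "v = 0") (auto simp: flux_def powr_diff powr_add[symmetric] powr_mult_base field_simps power2_eq_square)

lemma Lp_loc_dominated:
  fixes f :: "'a::euclidean_space \<Rightarrow> 'b::euclidean_space" and h :: "'a \<Rightarrow> 'c::euclidean_space"
  assumes "Lp_loc p G f" "open G" "h \<in> borel_measurable (lebesgue_on G)"
    and "\<And>x. norm (h x) \<le> 1 + norm (f x) powr p"
  shows "loc_int G h"
  unfolding loc_int_def
proof (intro conjI allI impI)
  fix K assume K: "compact K \<and> K \<subseteq> G"
  have c: "loc_int G (\<lambda>_. 1 :: real)"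
    using assms(2) by (intro loc_int_continuous continuous_intros)
  show "integrable (lebesgue_on K) h"
  proof (rule Bochner_Integration.integrable_bound)
    show "integrable (lebesgue_on K) (\<lambda>x. 1 + norm (f x) powr p)"
      using assms(1) K c by (auto simp: Lp_loc_def loc_int_def)
    show "h \<in> borel_measurable (lebesgue_on K)"
      using assms K by (meson measurable_restrict_mono)
    show "AE x in lebesgue_on K. norm (h x) \<le> norm (1 + norm (f x) powr p)"
      using assms(4) by (intro AE_I2) (smt (verit) powr_ge_zero real_norm_def)
  qed
qed (use assms in auto)

lemma powr_le_one_plus:
  fixes x a b :: real
  assumes "0 \<le> x" "0 \<le> a" "a \<le> b"
  shows "x powr a \<le> 1 + x powr b"
proof (cases "x \<le> 1")
  case True
  then have "x powr a \<le> 1"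
    using assms powr_mono2[of a x 1] by simp
  then show ?thesis by (smt (verit) powr_ge_zero)
next
  case False
  then have "x powr a \<le> x powr b" using assms by (intro powr_mono) auto
  then show ?thesis by simp
qed

lemma Lp_loc_imp_loc_int:
  fixes f :: "'a::euclidean_space \<Rightarrow> 'b::euclidean_space"
  assumes "Lp_loc p G f" "open G" "1 \<le> p"
  shows "loc_int G f"
proof (rule Lp_loc_dominated[OF assms(1,2)])
  show "norm (f x) \<le> 1 + norm (f x) powr p" for x
    using powr_le_one_plus[of "norm (f x)" 1 p] assms(3) by simp
qed (use assms in \<open>auto simp: Lp_loc_def\<close>)

lemma Lp_loc_imp_loc_int_flux:
  fixes g :: "'a::euclidean_space \<Rightarrow> 'a"
  assumes "Lp_loc p G g" "open G" "1 \<le> p"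
  shows "loc_int G (\<lambda>x. flux p (g x))"
proof (rule Lp_loc_dominated[OF assms(1,2)])
  show "norm (flux p (g x)) \<le> 1 + norm (g x) powr p" for x
    unfolding norm_flux using powr_le_one_plus[of "norm (g x)" "p - 1" p] assms(3) by simp
  have [measurable]: "g \<in> borel_measurable (lebesgue_on G)"
    using assms(1) by (auto simp: Lp_loc_def)
  show "(\<lambda>x. flux p (g x)) \<in> borel_measurable (lebesgue_on G)"
    unfolding flux_def by measurable
qed

lemma Lp_loc_continuous:
  fixes f :: "'a::euclidean_space \<Rightarrow> 'b::euclidean_space"
  assumes "open G" "continuous_on G f" "0 < p"
  shows "Lp_loc p G f"
proof -
  have "loc_int G (\<lambda>x. norm (f x) powr p)"
    using assms by (intro loc_int_continuous continuous_on_powr' continuous_intros) auto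
  moreover have "loc_int G f" using assms by (intro loc_int_continuous)
  ultimately show ?thesis by (auto simp: loc_int_def Lp_loc_def)
qed

lemma test_scaleR_integrable:
  fixes f :: "'a::euclidean_space \<Rightarrow> 'b::euclidean_space"
  assumes "loc_int G f" "open G" "test_function G \<eta>"
  shows "integrable (lebesgue_on G) (\<lambda>x. \<eta> x *\<^sub>R f x)"
proof -
  obtain K where K: "compact K" "K \<subseteq> G" "\<And>x. x \<notin> K \<Longrightarrow> \<eta> x = 0"
    using test_function_support[OF assms(3)] by blast
  show ?thesis
    using K assms test_continuous[OF assms(3)]
    by (intro loc_int_vanishing_integrable(2)[OF _ _ K(1)] loc_int_scaleR_continuous)
       (auto intro: continuous_on_subset)
qed

lemma test_scaleR_grad_integrable:
  fixes u :: "'a::euclidean_space \<Rightarrow> real"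
  assumes "continuous_on G u" "open G" "test_function G \<eta>"
  shows "integrable (lebesgue_on G) (\<lambda>x. u x *\<^sub>R grad \<eta> x)"
proof -
  obtain K where K: "compact K" "K \<subseteq> G" "\<And>x. x \<notin> K \<Longrightarrow> \<eta> x = 0"
    using test_function_support[OF assms(3)] by blast
  have "grad \<eta> x = 0" if "x \<notin> K" for x
    using grad_vanishing[of K \<eta> x] compact_imp_closed[OF K(1)] K(3) that by blast
  then show ?thesis
    using K assms test_continuous[OF assms(3)]
    by (intro loc_int_vanishing_integrable(2)[OF _ _ K(1)] loc_int_continuous continuous_intros)
       (auto intro: continuous_on_subset)
qed

text \<open>Testing against a fixed vector \<open>v\<close> replaces the vector-valued identity in the definition by scalar
  ones, to which integration by parts and the fundamental lemma apply.\<close>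

lemma weak_gradient_iff:
  fixes u :: "'a::euclidean_space \<Rightarrow> real"
  assumes "open G" "continuous_on G u" "loc_int G g"
  shows "weak_gradient G u g \<longleftrightarrow> (\<forall>\<eta> v. test_function G \<eta> \<longrightarrow>
    (LINT x|lebesgue_on G. u x * (grad \<eta> x \<bullet> v)) = - (LINT x|lebesgue_on G. \<eta> x * (g x \<bullet> v)))"
proof -
  have "(LINT x|lebesgue_on G. u x *\<^sub>R grad \<eta> x) \<bullet> v = (LINT x|lebesgue_on G. u x * (grad \<eta> x \<bullet> v))"
    and "(LINT x|lebesgue_on G. \<eta> x *\<^sub>R g x) \<bullet> v = (LINT x|lebesgue_on G. \<eta> x * (g x \<bullet> v))"
    if "test_function G \<eta>" for \<eta> v
    using test_scaleR_grad_integrable[OF assms(2,1) that] test_scaleR_integrable[OF assms(3,1) that]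
    by (simp_all flip: integral_inner_left)
  moreover have "a = - b \<longleftrightarrow> (\<forall>v. a \<bullet> v = - (b \<bullet> v))" for a b :: 'a
    by (metis euclidean_eqI inner_minus_left)
  ultimately show ?thesis
    unfolding weak_gradient_def by (auto simp: fun_eq_iff)
qed

lemma classical_weak_gradient:
  fixes u :: "'a::euclidean_space \<Rightarrow> real"
  assumes "open G" "\<And>x. x \<in> G \<Longrightarrow> (u has_derivative (\<lambda>h. F x \<bullet> h)) (at x)" "continuous_on G F"
  shows "weak_gradient G u F"
proof -
  have "continuous_on G u"
    using assms(2) by (meson continuous_at_imp_continuous_on has_derivative_continuous)
  then show ?thesis
    using assms integration_by_parts[OF assms(1) _ assms(2,3)]
    by (subst weak_gradient_iff) (auto intro: loc_int_continuous)
qed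

lemma fundamental_lemma_vector:
  fixes f :: "'a::euclidean_space \<Rightarrow> 'b::euclidean_space"
  assumes f: "loc_int G f" and G: "open G"
    and z: "\<And>\<eta> b. test_function G \<eta> \<Longrightarrow> b \<in> Basis \<Longrightarrow> (LINT x|lebesgue_on G. \<eta> x * (f x \<bullet> b)) = 0"
  shows "AE x in lebesgue_on G. f x = 0"
proof -
  have "AE x in lebesgue_on G. f x \<bullet> b = 0" if "b \<in> Basis" for b
    using z[OF _ that] by (intro fundamental_lemma loc_int_inner_continuous f G continuous_intros)
       (simp add: mult.commute)
  then have "AE x in lebesgue_on G. \<forall>b\<in>Basis. f x \<bullet> b = 0"
    by (intro AE_finite_allI) auto
  then show ?thesis
    by eventually_elim (simp add: euclidean_all_zero_iff)
qed

lemma weak_gradient_unique: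
  fixes u :: "'a::euclidean_space \<Rightarrow> real"
  assumes G: "open G" and u: "continuous_on G u" and g: "loc_int G g" "loc_int G g'"
    and w: "weak_gradient G u g" "weak_gradient G u g'"
  shows "AE x in lebesgue_on G. g x = g' x"
proof -
  have "AE x in lebesgue_on G. g x - g' x = 0"
  proof (rule fundamental_lemma_vector[OF loc_int_diff[OF g] G])
    fix \<eta> and b :: 'a assume t: "test_function G \<eta>"
    have "integrable (lebesgue_on G) (\<lambda>x. \<eta> x * (h x \<bullet> b))" if "loc_int G h" for h
      using test_integrable[OF loc_int_inner_continuous[OF that G] G t, of "\<lambda>_. b"]
      by (simp add: mult.commute)
    moreover have "(LINT x|lebesgue_on G. \<eta> x * (g x \<bullet> b)) = (LINT x|lebesgue_on G. \<eta> x * (g' x \<bullet> b))"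
      using w t by (simp add: weak_gradient_iff[OF G u g(1)] weak_gradient_iff[OF G u g(2)])
    ultimately show "(LINT x|lebesgue_on G. \<eta> x * ((g x - g' x) \<bullet> b)) = 0"
      using g by (simp add: inner_diff_left right_diff_distrib)
  qed
  then show ?thesis by simp
qed

section \<open>Weak homogeneity\<close>

lemma open_punctured: "open (- {0 :: 'a::euclidean_space})"
  by (simp add: open_Compl)

text \<open>The origin is a null set, so statements on the punctured space can be combined with statements that
  are transported by dilations of the whole space.\<close>

lemma AE_punctured:
  "(AE x in lebesgue_on (- {0}). P x) \<longleftrightarrow> (AE x in (lebesgue :: 'a::euclidean_space measure). P x)"
proof -
  have "AE x in (lebesgue :: 'a measure). x \<notin> {0}"
    by (intro AE_not_in) (simp add: negligible_iff_null_sets[symmetric])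
  then have "(AE x in lebesgue. x \<in> - {0} \<longrightarrow> P x) \<longleftrightarrow> (AE x in lebesgue. P x)"
    by (auto elim!: eventually_rev_mp)
  then show ?thesis
    by (subst AE_restrict_space_iff) (auto simp: open_Compl)
qed

lemma compact_scaled_range:
  fixes K :: "'a::euclidean_space set"
  assumes "compact K" "K \<subseteq> - {0}" "0 < a"
  shows "compact ((\<lambda>(r, x). r *\<^sub>R x) ` ({a..b} \<times> K))" "(\<lambda>(r, x). r *\<^sub>R x) ` ({a..b} \<times> K) \<subseteq> - {0}"
  using assms by (auto intro!: compact_continuous_image compact_Times continuous_intros
      simp: split_beta)

lemma loc_int_scale:
  fixes f :: "'a::euclidean_space \<Rightarrow> 'b::euclidean_space"
  assumes f: "loc_int (- {0}) f" and t: "t \<noteq> 0"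
  shows "loc_int (- {0}) (\<lambda>x. f (t *\<^sub>R x))"
  unfolding loc_int_def
proof (intro conjI allI impI)
  have S: "- {0 :: 'a} \<in> sets lebesgue" by (simp add: sets_lebesgue_open open_punctured)
  have "(\<lambda>x. if x \<in> - {0} then f x else 0) \<in> borel_measurable lebesgue"
    using f S by (intro borel_measurable_if_I) (auto simp: loc_int_def)
  from measurable_compose[OF measurable_scale_lebesgue[OF t] this]
  have "(\<lambda>x. if x \<in> - {0} then f (t *\<^sub>R x) else 0) \<in> borel_measurable lebesgue"
    using t by simp
  then show "(\<lambda>x. f (t *\<^sub>R x)) \<in> borel_measurable (lebesgue_on (- {0}))"
    by (rule borel_measurable_if_D)
  fix K :: "'a set" assume K: "compact K \<and> K \<subseteq> - {0}"
  have "integrable lebesgue (\<lambda>x. indicator ((\<lambda>x. t *\<^sub>R x) ` K) x *\<^sub>R f x)"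
    using K t by (intro loc_int_indicator[OF f] compact_scaling) auto
  from integrable_scale[OF this t]
  have "integrable lebesgue (\<lambda>x. indicator ((\<lambda>x. t *\<^sub>R x) ` K) (t *\<^sub>R x) *\<^sub>R f (t *\<^sub>R x))" .
  moreover have "indicator ((\<lambda>x. t *\<^sub>R x) ` K) (t *\<^sub>R x) = (indicator K x :: real)" for x
    using t by (auto simp: indicator_def image_iff)
  ultimately have "integrable lebesgue (\<lambda>x. indicator K x *\<^sub>R f (t *\<^sub>R x))" by simp
  then show "integrable (lebesgue_on K) (\<lambda>x. f (t *\<^sub>R x))"
    using K by (simp add: integrable_restrict_space sets_lebesgue_compact)
qed

lemma punctured_integral:
  fixes h :: "'a::euclidean_space \<Rightarrow> real"
  assumes "h \<in> borel_measurable (lebesgue_on (- {0}))" "t > 0"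
  shows "(LINT x|lebesgue_on (- {0}). h x) = t ^ DIM('a) * (LINT x|lebesgue_on (- {0}). h (t *\<^sub>R x))"
proof -
  have S: "- {0 :: 'a} \<in> sets lebesgue" by (simp add: sets_lebesgue_open open_punctured)
  have eq: "(LINT x|lebesgue_on (- {0}). k x) = (LINT x|lebesgue. (if x \<in> - {0} then k x else 0))" for k :: "'a \<Rightarrow> real"
    using S by (subst integral_restrict_space) (auto intro!: Bochner_Integration.integral_cong)
  have "(\<lambda>x. if x \<in> - {0} then h x else 0) \<in> borel_measurable lebesgue"
    using assms S by (intro borel_measurable_if_I)
  from integral_scale[OF this, of t] show ?thesis
    using assms(2) by (simp add: eq)
qed

text \<open>Differentiation under the integral sign produces, up to a power of \<open>s\<close>, the hypothesis for the test
  function \<open>\<eta>(s x)\<close>. For \<open>s\<close> between \<open>s0 / 2\<close> and \<open>2 s0\<close> the supports of all these functions lie in one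
  compact set that avoids the origin, which gives the dominating function.\<close>

lemma dilated_integral_derivative:
  fixes f :: "'a::euclidean_space \<Rightarrow> real"
  assumes f: "loc_int (- {0}) f" and t: "test_function (- {0}) \<eta>" and s0: "s0 > 0"
    and z: "\<And>\<eta>. test_function (- {0}) \<eta> \<Longrightarrow>
        (LINT x|lebesgue_on (- {0}). f x * (grad \<eta> x \<bullet> x + m * \<eta> x)) = 0"
  shows "((\<lambda>s. LINT x|lebesgue_on (- {0}). f x * (s powr m * \<eta> (s *\<^sub>R x))) has_real_derivative 0) (at s0)"
proof -
  let ?M = "lebesgue_on (- {0 :: 'a})"
  \<comment> \<open>\<open>s powr (m - 1) * \<zeta> (s *\<^sub>R x)\<close> is the derivative of \<open>\<theta> s x\<close> with respect to \<open>s\<close>.\<close>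
  define \<zeta> where "\<zeta> y = grad \<eta> y \<bullet> y + m * \<eta> y" for y
  define \<theta> where "\<theta> s x = s powr m * \<eta> (s *\<^sub>R x)" for s x
  obtain K where K: "compact K" "K \<subseteq> - {0}" "\<And>x. x \<notin> K \<Longrightarrow> \<eta> x = 0"
    using test_function_support[OF t] by blast
  have g0: "grad \<eta> x = 0" if "x \<notin> K" for x
    using grad_vanishing[of K \<eta> x] compact_imp_closed[OF K(1)] K(3) that by blast
  have "\<exists>B\<ge>0. \<forall>x. \<bar>\<zeta> x\<bar> \<le> B"
    using K g0 test_continuous[OF t]
    by (intro continuous_vanishing_bound[of _ K]) (auto simp: \<zeta>_def intro!: continuous_intros)
  then obtain B where B: "B \<ge> 0" "\<And>x. \<bar>\<zeta> x\<bar> \<le> B" by auto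
  have d\<theta>: "((\<lambda>s. \<theta> s x) has_real_derivative s powr (m - 1) * \<zeta> (s *\<^sub>R x)) (at s)" if "s > 0" for s x
  proof -
    have "((\<lambda>s. \<eta> (s *\<^sub>R x)) has_real_derivative grad \<eta> (s *\<^sub>R x) \<bullet> x) (at s)"
      unfolding has_field_derivative_def
      by (rule has_derivative_eq_rhs, rule has_derivative_compose[OF _ test_has_derivative[OF t]])
         (auto intro!: derivative_eq_intros simp: mult.commute)
    from DERIV_mult[OF has_real_derivative_powr[OF that, of m] this] show ?thesis
      unfolding \<theta>_def
      by (rule DERIV_cong) (use that in \<open>simp add: \<zeta>_def powr_diff field_simps\<close>)
  qed
  define C where "C = max ((s0 / 2) powr (m - 1)) ((2 * s0) powr (m - 1))"
  have C: "s powr (m - 1) \<le> C" if "s0 / 2 \<le> s" "s \<le> 2 * s0" for s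
  proof (cases "m \<ge> 1")
    case True
    then show ?thesis using that s0 powr_mono2[of "m - 1" s "2 * s0"] by (auto simp: C_def)
  next
    case False
    then show ?thesis using that s0 powr_mono2'[of "m - 1" "s0 / 2" s] by (auto simp: C_def)
  qed
  have C0: "C \<ge> 0" by (auto simp: C_def max_def)
  define K' where "K' = (\<lambda>(r, x). r *\<^sub>R x) ` ({1 / (2 * s0)..2 / s0} \<times> K)"
  have K': "compact K'" "K' \<subseteq> - {0}"
    unfolding K'_def using K s0 by (auto intro!: compact_scaled_range simp del: split_paired_All)
  have v: "\<theta> s x = 0" if "s0 / 2 \<le> s" "s \<le> 2 * s0" "x \<notin> K'" for s x
  proof -
    have "s *\<^sub>R x \<notin> K"
    proof
      assume "s *\<^sub>R x \<in> K"
      moreover have "inverse s \<in> {1 / (2 * s0)..2 / s0}"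
        using that s0 by (auto simp: field_simps)
      ultimately have "(\<lambda>(r, x). r *\<^sub>R x) (inverse s, s *\<^sub>R x) \<in> K'"
        unfolding K'_def by blast
      moreover have "(\<lambda>(r, x). r *\<^sub>R x) (inverse s, s *\<^sub>R x) = x" using that s0 by simp
      ultimately show False using that by simp
    qed
    then show ?thesis by (simp add: \<theta>_def K(3))
  qed
  have fm [measurable]: "f \<in> borel_measurable ?M" using f by (auto simp: loc_int_def)
  have int\<theta>: "integrable ?M (\<lambda>x. f x * \<theta> s x)" if "s > 0" for s
  proof -
    have "integrable ?M (\<lambda>x. s powr m * (f x * \<eta> (s *\<^sub>R x)))"
      using that by (intro integrable_mult_right test_integrable f open_punctured test_function_dilate t) auto
    then show ?thesis by (simp add: \<theta>_def mult.left_commute)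
  qed
  have wint: "integrable ?M (\<lambda>x. indicator K' x * f x)"
  proof -
    have "integrable lebesgue (\<lambda>x. indicator K' x *\<^sub>R f x)"
      by (rule loc_int_indicator[OF f K'])
    moreover have "indicator K' x *\<^sub>R f x = indicator (- {0}) x *\<^sub>R (indicator K' x * f x)" for x
      using K' by (auto simp: indicator_def)
    ultimately have "integrable lebesgue (\<lambda>x. indicator (- {0}) x *\<^sub>R (indicator K' x * f x))"
      by (simp only:)
    then show ?thesis
      by (subst integrable_restrict_space) (auto simp: sets_lebesgue_open open_punctured)
  qed
  have seq: "(\<lambda>i. ((LINT x|?M. f x * \<theta> (s0 + X i) x) - (LINT x|?M. f x * \<theta> s0 x)) / X i) \<longlonglongrightarrow> 0"
    if X0: "\<forall>i. X i \<noteq> 0" and X: "X \<longlonglongrightarrow> 0" for X :: "nat \<Rightarrow> real"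
  proof -
    have "eventually (\<lambda>i. X i \<in> {- (s0 / 2)<..<s0}) sequentially"
      using s0 by (intro topological_tendstoD[OF X]) auto
    then obtain N where N: "\<And>i. i \<ge> N \<Longrightarrow> X i \<in> {- (s0 / 2)<..<s0}"
      by (auto simp: eventually_sequentially)
    define Y where "Y i = X (i + N)" for i
    have Y: "Y \<longlonglongrightarrow> 0" unfolding Y_def using X by (rule LIMSEQ_ignore_initial_segment)
    have Yb: "Y i \<noteq> 0" "- (s0 / 2) < Y i" "Y i < s0" for i
      using X0 N[of "i + N"] by (auto simp: Y_def)
    have "(\<lambda>i. LINT x|?M. f x * ((\<theta> (s0 + Y i) x - \<theta> s0 x) / Y i)) \<longlonglongrightarrow>
        (LINT x|?M. f x * (s0 powr (m - 1) * \<zeta> (s0 *\<^sub>R x)))"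
    proof (rule integral_dominated_convergence)
      show "integrable ?M (\<lambda>x. C * B * \<bar>indicator K' x * f x\<bar>)"
        using wint by (intro integrable_mult_right integrable_abs)
      show "AE x in ?M. (\<lambda>i. f x * ((\<theta> (s0 + Y i) x - \<theta> s0 x) / Y i)) \<longlonglongrightarrow> f x * (s0 powr (m - 1) * \<zeta> (s0 *\<^sub>R x))"
      proof (intro AE_I2 tendsto_mult tendsto_const)
        fix x
        have "((\<lambda>h. (\<theta> (s0 + h) x - \<theta> s0 x) / h) \<longlongrightarrow> s0 powr (m - 1) * \<zeta> (s0 *\<^sub>R x)) (at 0)"
          using d\<theta>[OF s0, of x] by (simp add: DERIV_def)
        then show "(\<lambda>i. (\<theta> (s0 + Y i) x - \<theta> s0 x) / Y i) \<longlonglongrightarrow> s0 powr (m - 1) * \<zeta> (s0 *\<^sub>R x)"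
          by (rule filterlim_compose) (use Y Yb in \<open>auto simp: filterlim_at\<close>)
      qed
      show "AE x in ?M. norm (f x * ((\<theta> (s0 + Y i) x - \<theta> s0 x) / Y i)) \<le> C * B * \<bar>indicator K' x * f x\<bar>" for i
      proof (intro AE_I2)
        fix x
        show "norm (f x * ((\<theta> (s0 + Y i) x - \<theta> s0 x) / Y i)) \<le> C * B * \<bar>indicator K' x * f x\<bar>"
        proof (cases "x \<in> K'")
          case False
          then show ?thesis using v[of "s0 + Y i" x] v[of s0 x] Yb[of i] s0 by simp
        next
          case True
          have "norm (\<theta> (s0 + Y i) x - \<theta> s0 x) \<le> (C * B) * norm ((s0 + Y i) - s0)"
          proof (rule field_differentiable_bound[of "{s0 / 2..2 * s0}"])
            fix s assume s: "s \<in> {s0 / 2..2 * s0}"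
            then show "((\<lambda>s. \<theta> s x) has_field_derivative s powr (m - 1) * \<zeta> (s *\<^sub>R x)) (at s within {s0 / 2..2 * s0})"
              using s0 by (intro has_field_derivative_at_within[OF d\<theta>]) auto
            show "norm (s powr (m - 1) * \<zeta> (s *\<^sub>R x)) \<le> C * B"
              using C[of s] B C0 s by (auto simp: abs_mult intro!: mult_mono)
          qed (use Yb[of i] s0 in auto)
          then have "\<bar>(\<theta> (s0 + Y i) x - \<theta> s0 x) / Y i\<bar> \<le> C * B"
            using Yb[of i] by (simp add: field_simps)
          then have "\<bar>f x\<bar> * \<bar>(\<theta> (s0 + Y i) x - \<theta> s0 x) / Y i\<bar> \<le> \<bar>f x\<bar> * (C * B)"
            by (intro mult_left_mono) auto
          then show ?thesis using True by (simp only: real_norm_def abs_mult) (simp add: ac_simps)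
        qed
      qed
      have c\<zeta>: "continuous_on UNIV (\<lambda>x. s0 powr (m - 1) * \<zeta> (s0 *\<^sub>R x))"
        unfolding \<zeta>_def
        by (intro continuous_intros continuous_on_compose2[OF test_continuous(1)[OF t]]
            continuous_on_compose2[OF test_continuous(2)[OF t]]) auto
      have c\<theta>: "continuous_on UNIV (\<theta> s)" for s
        unfolding \<theta>_def
        by (intro continuous_intros continuous_on_compose2[OF test_continuous(1)[OF t]]) auto
      show "(\<lambda>x. f x * (s0 powr (m - 1) * \<zeta> (s0 *\<^sub>R x))) \<in> borel_measurable ?M"
        by (rule borel_measurable_times[OF fm measurable_restrict_space1[OF continuous_measurable_lebesgue[OF c\<zeta>]]])
      show "(\<lambda>x. f x * ((\<theta> (s0 + Y i) x - \<theta> s0 x) / Y i)) \<in> borel_measurable ?M" for i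
        by (intro borel_measurable_times[OF fm] borel_measurable_divide borel_measurable_diff
            measurable_restrict_space1[OF continuous_measurable_lebesgue[OF c\<theta>]] borel_measurable_const)
    qed
    also have "(LINT x|?M. f x * (s0 powr (m - 1) * \<zeta> (s0 *\<^sub>R x))) = 0"
    proof -
      have gr: "grad (\<lambda>x. \<eta> (s0 *\<^sub>R x)) x = s0 *\<^sub>R grad \<eta> (s0 *\<^sub>R x)" for x
        by (intro grad_eqI, rule has_derivative_eq_rhs, rule has_derivative_compose[OF _ test_has_derivative[OF t]])
           (auto intro!: derivative_eq_intros)
      have "(LINT x|?M. f x * \<zeta> (s0 *\<^sub>R x)) = 0"
        using z[OF test_function_dilate[OF t, of s0]] s0 by (simp add: gr \<zeta>_def)
      then have "s0 powr (m - 1) * (LINT x|?M. f x * \<zeta> (s0 *\<^sub>R x)) = 0" by simp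
      then show ?thesis by (simp add: mult.left_commute flip: integral_mult_right_zero)
    qed
    also have "(\<lambda>i. LINT x|?M. f x * ((\<theta> (s0 + Y i) x - \<theta> s0 x) / Y i)) =
        (\<lambda>i. ((LINT x|?M. f x * \<theta> (s0 + Y i) x) - (LINT x|?M. f x * \<theta> s0 x)) / Y i)"
    proof
      fix i
      have "s0 + Y i > 0" using Yb[of i] s0 by simp
      then show "(LINT x|?M. f x * ((\<theta> (s0 + Y i) x - \<theta> s0 x) / Y i)) =
          ((LINT x|?M. f x * \<theta> (s0 + Y i) x) - (LINT x|?M. f x * \<theta> s0 x)) / Y i"
        using int\<theta>[of "s0 + Y i"] int\<theta>[OF s0] 
        by (simp add: right_diff_distrib diff_divide_distrib)
    qed
    finally have lim: "(\<lambda>i. ((LINT x|?M. f x * \<theta> (s0 + Y i) x) - (LINT x|?M. f x * \<theta> s0 x)) / Y i) \<longlonglongrightarrow> 0" .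
    show ?thesis
      by (rule LIMSEQ_offset[of _ N]) (rule lim[unfolded Y_def])
  qed
  have "((\<lambda>h. ((LINT x|?M. f x * \<theta> (s0 + h) x) - (LINT x|?M. f x * \<theta> s0 x)) / h) \<longlongrightarrow> 0) (at 0)"
    unfolding tendsto_at_iff_sequentially o_def by (intro allI impI seq) auto
  then show ?thesis by (simp add: DERIV_def \<theta>_def)
qed

text \<open>This is Euler's theorem on homogeneous functions in distributional form: the hypothesis says
  \<open>x \<bullet> \<nabla>f = (m - n) f\<close> in the weak sense, where \<open>n\<close> is the dimension. By
  \<open>dilated_integral_derivative\<close> the integral of \<open>f\<close> against \<open>s\<^sup>m \<eta>(s x)\<close> does not depend on \<open>s\<close>; substituting
  \<open>x = t y\<close> with \<open>t = 1 / s\<close> moves the dilation to \<open>f\<close>.\<close>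

theorem weakly_homogeneous_imp_homogeneous:
  fixes f :: "'a::euclidean_space \<Rightarrow> real"
  assumes f: "loc_int (- {0}) f" and t: "t > 0"
    and z: "\<And>\<eta>. test_function (- {0}) \<eta> \<Longrightarrow>
        (LINT x|lebesgue_on (- {0}). f x * (grad \<eta> x \<bullet> x + m * \<eta> x)) = 0"
  shows "AE x in lebesgue. f (t *\<^sub>R x) = t powr (m - DIM('a)) * f x"
proof -
  let ?M = "lebesgue_on (- {0 :: 'a})"
  have fm [measurable]: "f \<in> borel_measurable ?M" using f by (auto simp: loc_int_def)
  have lt: "loc_int (- {0}) (\<lambda>x. t powr (DIM('a) - m) *\<^sub>R f (t *\<^sub>R x))"
    using t by (intro loc_int_scaleR_continuous loc_int_scale f open_punctured continuous_intros) auto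
  have "AE x in ?M. t powr (DIM('a) - m) *\<^sub>R f (t *\<^sub>R x) - f x = 0"
  proof (rule fundamental_lemma[OF loc_int_diff[OF lt f] open_punctured])
    fix \<eta> assume test: "test_function (- {0 :: 'a}) \<eta>"
    define s where "s = inverse t"
    have s: "s > 0" using t by (simp add: s_def)
    define \<Phi> where "\<Phi> s = (LINT x|?M. f x * (s powr m * \<eta> (s *\<^sub>R x)))" for s
    have "(\<Phi> has_real_derivative 0) (at x)" if "x > 0" for x
      unfolding \<Phi>_def using that by (intro dilated_integral_derivative f test z)
    then have "\<Phi> s = \<Phi> 1"
      using s by (intro DERIV_isconst3[of 0 "s + 2"]) auto
    moreover have "\<Phi> s = (LINT x|?M. (t powr (DIM('a) - m) *\<^sub>R f (t *\<^sub>R x)) * \<eta> x)"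
    proof -
      have "continuous_on UNIV (\<lambda>x. s powr m * \<eta> (s *\<^sub>R x))"
        by (intro continuous_intros continuous_on_compose2[OF test_continuous(1)[OF test]]) auto
      note meas = borel_measurable_times[OF fm measurable_restrict_space1[OF continuous_measurable_lebesgue[OF this]]]
      have "\<Phi> s = t ^ DIM('a) * (LINT x|?M. f (t *\<^sub>R x) * (s powr m * \<eta> (s *\<^sub>R (t *\<^sub>R x))))"
        unfolding \<Phi>_def by (rule punctured_integral[OF meas t])
      also have "\<dots> = t ^ DIM('a) * s powr m * (LINT x|?M. f (t *\<^sub>R x) * \<eta> x)"
        using t by (simp add: s_def mult.left_commute)
      also have "t ^ DIM('a) * s powr m = t powr (DIM('a) - m)"
        using t by (simp add: s_def powr_diff powr_realpow inverse_powr divide_inverse powr_minus)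
      finally show ?thesis by (simp add: mult.assoc)
    qed
    moreover have "\<Phi> 1 = (LINT x|?M. f x * \<eta> x)"
      by (simp add: \<Phi>_def)
    ultimately show "(LINT x|?M. (t powr (DIM('a) - m) *\<^sub>R f (t *\<^sub>R x) - f x) * \<eta> x) = 0"
      using test_integrable[OF lt open_punctured test] test_integrable[OF f open_punctured test]
      by (simp add: left_diff_distrib)
  qed
  then have "AE x in lebesgue. t powr (DIM('a) - m) *\<^sub>R f (t *\<^sub>R x) - f x = 0"
    by (simp add: AE_punctured)
  then show ?thesis
    by eventually_elim (use t in \<open>simp add: powr_diff field_simps\<close>)
qed

section \<open>Radial p-harmonic functions\<close>

text \<open>The flux map is a bijection, homogeneous of degree \<open>p - 1\<close>; its inverse is
  \<open>w \<mapsto> |w|\<^sup>q w\<close> with \<open>q = (2 - p) / (p - 1)\<close>.\<close>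

lemma flux_scaleR_cancel:
  assumes "flux p v = c *\<^sub>R flux p u" "c > 0" "p > 1"
  shows "v = c powr (1 / (p - 1)) *\<^sub>R u"
proof -
  have inv: "norm (flux p v) powr ((2 - p) / (p - 1)) *\<^sub>R flux p v = v" for v :: 'a
  proof (cases "v = 0")
    case False
    have "norm (flux p v) powr ((2 - p) / (p - 1)) * norm v powr (p - 2) = norm v powr ((p - 1) * ((2 - p) / (p - 1)) + (p - 2))"
      by (simp add: norm_flux powr_powr powr_add)
    also have "\<dots> = 1" using assms(3) False by simp
    finally show ?thesis by (simp add: flux_def)
  qed (simp add: flux_def)
  have "v = norm (flux p v) powr ((2 - p) / (p - 1)) *\<^sub>R flux p v"
    by (simp add: inv)
  also have "\<dots> = (c powr ((2 - p) / (p - 1)) * c) *\<^sub>R (norm (flux p u) powr ((2 - p) / (p - 1)) *\<^sub>R flux p u)"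
    using assms(2) by (simp add: assms(1) powr_mult ac_simps)
  also have "c powr ((2 - p) / (p - 1)) * c = c powr ((2 - p) / (p - 1) + 1)"
    using assms(2) by (simp add: powr_add)
  also have "(2 - p) / (p - 1) + 1 = 1 / (p - 1)"
    using assms(3) by (simp add: field_simps)
  finally show ?thesis by (simp add: inv)
qed

lemma grad_inner_mult:
  assumes "test_function G \<eta>"
  shows "grad (\<lambda>x. (x \<bullet> b) * \<eta> x) x = (x \<bullet> b) *\<^sub>R grad \<eta> x + \<eta> x *\<^sub>R b"
  by (intro grad_eqI, rule has_derivative_eq_rhs,
      rule has_derivative_mult[OF has_derivative_inner_left[OF has_derivative_ident] test_has_derivative[OF assms]])
     (simp add: fun_eq_iff inner_add_left inner_add_right inner_commute)

lemma test_inner_mult: "test_function G \<eta> \<Longrightarrow> test_function G (\<lambda>x. (x \<bullet> b) * \<eta> x)"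
  by (rule test_function_mult[OF _ Ck_inner])

lemma continuous_on_real_polynomial:
  fixes q :: "real \<Rightarrow> real"
  assumes "real_polynomial_function q" "continuous_on S h"
  shows "continuous_on S (\<lambda>x. q (h x))"
proof -
  have "continuous_on UNIV q"
    using assms(1) by (intro continuous_on_polymonial_function) (simp add: real_polynomial_function_eq)
  then show ?thesis by (rule continuous_on_compose2[OF _ assms(2)]) simp
qed

text \<open>The vector field \<open>(x \<bullet> b) c - (x \<bullet> c) b\<close> generates rotations and annihilates radial functions. For a
  smooth radial function the identity is integration by parts. A merely continuous \<open>\<rho>\<close> is reduced to this
  case by the Weierstrass theorem: on the support of \<open>\<eta>\<close> it is a uniform limit of polynomials in \<open>|x|\<^sup>2\<close>,
  which are smooth also at the origin.\<close>

lemma radial_tangential_integral: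
  fixes \<rho> :: "real \<Rightarrow> real" and b c :: "'a::euclidean_space"
  assumes w: "continuous_on (- {0 :: 'a}) (\<lambda>x. \<rho> (norm x))" and t: "test_function (- {0 :: 'a}) \<eta>"
  shows "(LINT x|lebesgue_on (- {0}). \<rho> (norm x) * (grad \<eta> x \<bullet> ((x \<bullet> b) *\<^sub>R c - (x \<bullet> c) *\<^sub>R b))) = 0"
    (is "?I = 0")
proof -
  let ?M = "lebesgue_on (- {0 :: 'a})"
  define T where "T x = grad \<eta> x \<bullet> ((x \<bullet> b) *\<^sub>R c - (x \<bullet> c) *\<^sub>R b)" for x
  obtain K where K: "compact K" "K \<subseteq> - {0}" "\<And>x. x \<notin> K \<Longrightarrow> \<eta> x = 0"
    using test_function_support[OF t] by blast
  have g0: "grad \<eta> x = 0" if "x \<notin> K" for x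
    using grad_vanishing[of K \<eta> x] compact_imp_closed[OF K(1)] K(3) that by blast
  have cT: "continuous_on UNIV T"
    unfolding T_def using test_continuous[OF t] by (intro continuous_intros)
  have intT: "integrable ?M (\<lambda>x. k x * T x)" if "continuous_on (- {0}) k" for k
    using that continuous_on_subset[OF cT] K g0
    by (intro loc_int_vanishing_integrable(2)[OF _ _ K(1)] loc_int_continuous continuous_intros)
       (auto simp: T_def open_punctured)
  \<comment> \<open>Integration by parts leaves an expression symmetric in \<open>b\<close> and \<open>c\<close>, so the difference vanishes.\<close>
  have poly0: "(LINT x|?M. q ((norm x)\<^sup>2) * T x) = 0" if q: "real_polynomial_function q" for q
  proof -
    obtain q' where q': "real_polynomial_function q'" "\<And>x. (q has_real_derivative q' x) (at x)"
      using has_real_derivative_polynomial_function[OF q] by blast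
    have cq: "continuous_on S (\<lambda>x. q ((norm x)\<^sup>2))" "continuous_on S (\<lambda>x. q' ((norm x)\<^sup>2))" for S :: "'a set"
      by (intro continuous_on_real_polynomial[OF q] continuous_on_real_polynomial[OF q'(1)] continuous_intros)+
    have dk: "((\<lambda>x. q ((norm x)\<^sup>2) * (x \<bullet> b)) has_derivative
        (\<lambda>h. ((2 * q' ((norm x)\<^sup>2) * (x \<bullet> b)) *\<^sub>R x + q ((norm x)\<^sup>2) *\<^sub>R b) \<bullet> h)) (at x)" for x b :: 'a
    proof -
      have "((\<lambda>x. q (x \<bullet> x)) has_derivative (\<lambda>h. q' (x \<bullet> x) * (2 * (x \<bullet> h)))) (at x)"
        by (rule has_derivative_eq_rhs, rule has_derivative_compose[OF _ q'(2)[unfolded has_field_derivative_def]])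
           (auto intro!: derivative_eq_intros simp: inner_commute)
      from has_derivative_mult[OF this has_derivative_inner_left[OF has_derivative_ident, of b]] show ?thesis
        unfolding power2_norm_eq_inner
        by (rule has_derivative_eq_rhs) (simp add: fun_eq_iff inner_add_left inner_commute[of _ b])
    qed
    have ibp: "(LINT x|?M. (q ((norm x)\<^sup>2) * (x \<bullet> b)) * (grad \<eta> x \<bullet> c))
       = - (LINT x|?M. \<eta> x * (2 * q' ((norm x)\<^sup>2) * (x \<bullet> b) * (x \<bullet> c) + q ((norm x)\<^sup>2) * (b \<bullet> c)))" for b c
      using integration_by_parts[OF open_punctured t dk, of b c]
      by (simp add: cq inner_add_left continuous_intros)
    have int1: "integrable ?M (\<lambda>x. (q ((norm x)\<^sup>2) * (x \<bullet> b)) * (grad \<eta> x \<bullet> c))" for b c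
      using test_continuous[OF t] K g0
      by (intro loc_int_vanishing_integrable(2)[OF _ _ K(1)] loc_int_continuous continuous_intros cq)
         (auto simp: open_punctured intro: continuous_on_subset)
    have "(LINT x|?M. q ((norm x)\<^sup>2) * T x) = 
        (LINT x|?M. (q ((norm x)\<^sup>2) * (x \<bullet> b)) * (grad \<eta> x \<bullet> c))
      - (LINT x|?M. (q ((norm x)\<^sup>2) * (x \<bullet> c)) * (grad \<eta> x \<bullet> b))"
      using int1[of b c] int1[of c b] by (simp add: T_def inner_diff_right algebra_simps)
    also have "\<dots> = 0"
      unfolding ibp by (simp add: ac_simps inner_commute)
    finally show ?thesis .
  qed
  define J where "J = (LINT x|?M. \<bar>T x\<bar>)"
  have iT: "integrable ?M T" using intT[of "\<lambda>_. 1"] by simp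
  have bound: "\<bar>?I\<bar> \<le> e * J" if e: "e > 0" for e
  proof -
    have "continuous_on {0<..} \<rho>"
    proof -
      obtain i :: 'a where i: "i \<in> Basis" using nonempty_Basis by blast
      have "continuous_on {0<..} (\<lambda>r. \<rho> (norm (r *\<^sub>R i)))"
        using i by (intro continuous_on_compose2[OF w] continuous_intros) auto
      then show ?thesis
        by (rule continuous_on_eq) (use i in auto)
    qed
    then have cont: "continuous_on ((\<lambda>x. (norm x)\<^sup>2) ` K) (\<lambda>s. \<rho> (sqrt s))"
    proof (rule continuous_on_compose2)
      show "continuous_on ((\<lambda>x. (norm x)\<^sup>2) ` K) sqrt"
        by (intro continuous_intros)
      show "sqrt ` (\<lambda>x. (norm x)\<^sup>2) ` K \<subseteq> {0<..}"
        using K(2) by auto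
    qed
    have cpt: "compact ((\<lambda>x. (norm x)\<^sup>2) ` K)"
      by (intro compact_continuous_image continuous_intros K)
    obtain q where q: "real_polynomial_function q"
        "\<And>s. s \<in> (\<lambda>x. (norm x)\<^sup>2) ` K \<Longrightarrow> \<bar>\<rho> (sqrt s) - q s\<bar> < e"
      using Stone_Weierstrass_real_polynomial_function[OF cpt cont e] by blast
    have cq: "continuous_on S (\<lambda>x. q ((norm x)\<^sup>2))" for S :: "'a set"
      by (intro continuous_on_real_polynomial[OF q(1)] continuous_intros)
    have i1: "integrable ?M (\<lambda>x. \<rho> (norm x) * T x)" by (rule intT[OF w])
    have i2: "integrable ?M (\<lambda>x. q ((norm x)\<^sup>2) * T x)" by (rule intT[OF cq])
    have "?I = (LINT x|?M. \<rho> (norm x) * T x) - (LINT x|?M. q ((norm x)\<^sup>2) * T x)"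
      using poly0[OF q(1)] by (simp add: T_def)
    also have "\<dots> = (LINT x|?M. (\<rho> (norm x) - q ((norm x)\<^sup>2)) * T x)"
      using i1 i2 by (simp add: left_diff_distrib)
    also have "\<bar>\<dots>\<bar> \<le> (LINT x|?M. e * \<bar>T x\<bar>)"
    proof (rule integral_abs_bound_integral)
      show "integrable ?M (\<lambda>x. (\<rho> (norm x) - q ((norm x)\<^sup>2)) * T x)"
        using i1 i2 by (simp add: left_diff_distrib)
      show "integrable ?M (\<lambda>x. e * \<bar>T x\<bar>)" using iT by simp
      show "\<bar>(\<rho> (norm x) - q ((norm x)\<^sup>2)) * T x\<bar> \<le> e * \<bar>T x\<bar>" for x
      proof (cases "x \<in> K")
        case True
        then have "\<bar>\<rho> (norm x) - q ((norm x)\<^sup>2)\<bar> \<le> e"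
          using q(2)[of "(norm x)\<^sup>2"] by simp
        then show ?thesis by (simp add: abs_mult mult_right_mono)
      qed (simp add: T_def g0)
    qed
    finally show ?thesis by (simp add: J_def)
  qed
  have "J \<ge> 0" by (simp add: J_def)
  show ?thesis
  proof (rule ccontr)
    assume "?I \<noteq> 0"
    then have "\<bar>?I\<bar> > 0" by simp
    moreover have "\<bar>?I\<bar> \<le> \<bar>?I\<bar> / (J + 1) / 2 * J"
      using \<open>J \<ge> 0\<close> \<open>?I \<noteq> 0\<close> by (intro bound) auto
    moreover have "\<bar>?I\<bar> / (J + 1) / 2 * J < \<bar>?I\<bar>"
    proof -
      have "\<bar>?I\<bar> * J < \<bar>?I\<bar> * (2 * (J + 1))"
        using \<open>\<bar>?I\<bar> > 0\<close> \<open>J \<ge> 0\<close> by (intro mult_strict_left_mono) auto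
      then show ?thesis using \<open>J \<ge> 0\<close> by (simp add: field_simps)
    qed
    ultimately show False by linarith
  qed
qed

text \<open>The preceding identity is transferred to \<open>g\<close> by testing with \<open>(x \<bullet> b) \<eta>\<close> and \<open>(x \<bullet> c) \<eta>\<close>: in the
  difference the terms with \<open>b \<bullet> c\<close> cancel, and the tangential components of \<open>g\<close> remain.\<close>

lemma radial_weak_gradient:
  fixes \<rho> :: "real \<Rightarrow> real" and g :: "'a::euclidean_space \<Rightarrow> 'a"
  assumes w: "continuous_on (- {0 :: 'a}) (\<lambda>x. \<rho> (norm x))" and g: "loc_int (- {0}) g"
    and wg: "weak_gradient (- {0}) (\<lambda>x. \<rho> (norm x)) g"
  shows "AE x in lebesgue. (norm x)\<^sup>2 *\<^sub>R g x = (g x \<bullet> x) *\<^sub>R x"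
proof -
  let ?M = "lebesgue_on (- {0 :: 'a})"
  note wgi = wg[unfolded weak_gradient_iff[OF open_punctured w g], rule_format]
  have "AE x in ?M. g x \<bullet> ((x \<bullet> b) *\<^sub>R c - (x \<bullet> c) *\<^sub>R b) = 0" for b c
  proof (rule fundamental_lemma[OF _ open_punctured])
    show "loc_int (- {0}) (\<lambda>x. g x \<bullet> ((x \<bullet> b) *\<^sub>R c - (x \<bullet> c) *\<^sub>R b))"
      by (intro loc_int_inner_continuous g open_punctured continuous_intros)
    fix \<eta> assume t: "test_function (- {0 :: 'a}) \<eta>"
    have iw: "integrable ?M (\<lambda>x. \<rho> (norm x) * (grad (\<lambda>x. (x \<bullet> b) * \<eta> x) x \<bullet> c))" for b c
      using test_grad_integrable[OF loc_int_continuous[OF open_punctured] open_punctured test_inner_mult[OF t, of b],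
          of "\<lambda>x. \<rho> (norm x) *\<^sub>R c"] w
      by (simp add: inner_commute continuous_intros)
    have ig: "integrable ?M (\<lambda>x. ((x \<bullet> b) * \<eta> x) * (g x \<bullet> c))" for b c
      using test_integrable[OF loc_int_inner_continuous[OF g open_punctured] open_punctured test_inner_mult[OF t], of "\<lambda>_. c" b]
      by (simp add: mult.commute)
    have "0 = (LINT x|?M. \<rho> (norm x) * (grad \<eta> x \<bullet> ((x \<bullet> b) *\<^sub>R c - (x \<bullet> c) *\<^sub>R b)))"
      using radial_tangential_integral[OF w t] by simp
    also have "\<dots> = (LINT x|?M. \<rho> (norm x) * (grad (\<lambda>x. (x \<bullet> b) * \<eta> x) x \<bullet> c)
        - \<rho> (norm x) * (grad (\<lambda>x. (x \<bullet> c) * \<eta> x) x \<bullet> b))"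
      unfolding grad_inner_mult[OF t]
      by (intro Bochner_Integration.integral_cong)
         (auto simp: inner_add_left inner_diff_right inner_commute[of c b] algebra_simps)
    also have "\<dots> = (LINT x|?M. \<rho> (norm x) * (grad (\<lambda>x. (x \<bullet> b) * \<eta> x) x \<bullet> c))
        - (LINT x|?M. \<rho> (norm x) * (grad (\<lambda>x. (x \<bullet> c) * \<eta> x) x \<bullet> b))"
      by (rule Bochner_Integration.integral_diff[OF iw iw])
    also have "\<dots> = - (LINT x|?M. ((x \<bullet> b) * \<eta> x) * (g x \<bullet> c)) + (LINT x|?M. ((x \<bullet> c) * \<eta> x) * (g x \<bullet> b))"
      by (simp add: wgi test_inner_mult[OF t])
    also have "\<dots> = - (LINT x|?M. ((x \<bullet> b) * \<eta> x) * (g x \<bullet> c) - ((x \<bullet> c) * \<eta> x) * (g x \<bullet> b))"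
      by (subst Bochner_Integration.integral_diff[OF ig ig]) simp
    finally show "(LINT x|?M. (g x \<bullet> ((x \<bullet> b) *\<^sub>R c - (x \<bullet> c) *\<^sub>R b)) * \<eta> x) = 0"
      by (simp add: inner_diff_right algebra_simps)
  qed
  then have "AE x in lebesgue. \<forall>b\<in>Basis. \<forall>c\<in>Basis. g x \<bullet> ((x \<bullet> b) *\<^sub>R c - (x \<bullet> c) *\<^sub>R b) = 0"
    unfolding AE_punctured by (intro AE_finite_allI) auto
  then show ?thesis
  proof eventually_elim
    fix x assume *: "\<forall>b\<in>Basis. \<forall>c\<in>Basis. g x \<bullet> ((x \<bullet> b) *\<^sub>R c - (x \<bullet> c) *\<^sub>R b) = 0"
    show "(norm x)\<^sup>2 *\<^sub>R g x = (g x \<bullet> x) *\<^sub>R x"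
    proof (rule euclidean_eqI)
      fix c :: 'a assume c: "c \<in> Basis"
      have "(norm x)\<^sup>2 * (g x \<bullet> c) = (\<Sum>b\<in>Basis. (x \<bullet> b) * (x \<bullet> b)) * (g x \<bullet> c)"
        by (simp add: power2_norm_eq_inner euclidean_inner[of x x])
      also have "\<dots> = (\<Sum>b\<in>Basis. (x \<bullet> b) * ((x \<bullet> b) * (g x \<bullet> c)))"
        by (simp add: sum_distrib_left sum_distrib_right ac_simps)
      also have "\<dots> = (\<Sum>b\<in>Basis. (x \<bullet> b) * ((x \<bullet> c) * (g x \<bullet> b)))"
        using * c by (intro sum.cong refl) (simp add: inner_diff_right)
      also have "\<dots> = (g x \<bullet> x) * (x \<bullet> c)"
        by (simp add: euclidean_inner[of "g x" x] sum_distrib_right sum_distrib_left ac_simps)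
      finally show "((norm x)\<^sup>2 *\<^sub>R g x) \<bullet> c = ((g x \<bullet> x) *\<^sub>R x) \<bullet> c" by simp
    qed
  qed
qed

text \<open>As \<open>g x\<close> is parallel to \<open>x\<close>, so is the flux, say \<open>f(x) x\<close>. The equation is then the hypothesis of
  \<open>weakly_homogeneous_imp_homogeneous\<close> with \<open>m = 0\<close>: \<open>f\<close> has degree \<open>- n\<close> and the flux has degree \<open>1 - n\<close>.
  Inverting the flux map divides the degree by \<open>p - 1\<close>.\<close>

lemma radial_p_harmonic_gradient_homogeneous:
  fixes \<rho> :: "real \<Rightarrow> real" and g :: "'a::euclidean_space \<Rightarrow> 'a"
  assumes w: "continuous_on (- {0 :: 'a}) (\<lambda>x. \<rho> (norm x))" and p: "p > 1"
    and g: "Lp_loc p (- {0}) g" and wg: "weak_gradient (- {0}) (\<lambda>x. \<rho> (norm x)) g"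
    and div: "\<And>\<eta>. test_function (- {0}) \<eta> \<Longrightarrow> (LINT x|lebesgue_on (- {0}). flux p (g x) \<bullet> grad \<eta> x) = 0"
    and t: "t > 0"
  shows "AE x in lebesgue. g (t *\<^sub>R x) = t powr ((1 - real DIM('a)) / (p - 1)) *\<^sub>R g x"
proof -
  let ?M = "lebesgue_on (- {0 :: 'a})"
  have gl: "loc_int (- {0}) g"
    using Lp_loc_imp_loc_int[OF g open_punctured] p by simp
  have Fl: "loc_int (- {0}) (\<lambda>x. flux p (g x))"
    using Lp_loc_imp_loc_int_flux[OF g open_punctured] p by simp
  define f where "f x = flux p (g x) \<bullet> (x /\<^sub>R (norm x)\<^sup>2)" for x
  have fl: "loc_int (- {0}) f"
    unfolding f_def by (intro loc_int_inner_continuous Fl open_punctured continuous_intros) auto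
  have n0: "AE x in lebesgue. x \<noteq> (0 :: 'a)"
    unfolding AE_punctured[symmetric] by (intro AE_I2) (simp add: space_restrict_space)
  have Ff: "AE x in lebesgue. flux p (g x) = f x *\<^sub>R x"
    using radial_weak_gradient[OF w gl wg] n0
  proof eventually_elim
    fix x assume *: "(norm x)\<^sup>2 *\<^sub>R g x = (g x \<bullet> x) *\<^sub>R x" "x \<noteq> 0"
    have "g x = inverse ((norm x)\<^sup>2) *\<^sub>R ((norm x)\<^sup>2 *\<^sub>R g x)" using *(2) by simp
    also have "\<dots> = ((g x \<bullet> x) / (norm x)\<^sup>2) *\<^sub>R x"
      unfolding *(1) by (simp add: divide_inverse mult.commute)
    finally have "g x = ((g x \<bullet> x) / (norm x)\<^sup>2) *\<^sub>R x" .
    then obtain c where F: "flux p (g x) = c *\<^sub>R x"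
      unfolding flux_def by (metis scaleR_scaleR)
    have "f x = c"
      unfolding f_def F using *(2) by (simp add: power2_norm_eq_inner)
    with F show "flux p (g x) = f x *\<^sub>R x" by simp
  qed
  have "AE x in lebesgue. f (t *\<^sub>R x) = t powr (0 - real DIM('a)) * f x"
  proof (rule weakly_homogeneous_imp_homogeneous[OF fl t])
    fix \<eta> assume test: "test_function (- {0 :: 'a}) \<eta>"
    have "(LINT x|?M. f x * (grad \<eta> x \<bullet> x + 0 * \<eta> x)) = (LINT x|?M. flux p (g x) \<bullet> grad \<eta> x)"
    proof (rule integral_cong_AE)
      show "AE x in ?M. f x * (grad \<eta> x \<bullet> x + 0 * \<eta> x) = flux p (g x) \<bullet> grad \<eta> x"
        unfolding AE_punctured using Ff by eventually_elim (simp add: inner_commute)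
      have cg: "continuous_on (- {0}) (grad \<eta>)"
        using test_continuous(2)[OF test] by (auto intro: continuous_on_subset)
      have "loc_int (- {0}) (\<lambda>x. f x * (grad \<eta> x \<bullet> x))"
        using cg by (intro loc_int_mult_continuous fl open_punctured continuous_intros)
      then show "(\<lambda>x. f x * (grad \<eta> x \<bullet> x + 0 * \<eta> x)) \<in> borel_measurable ?M"
        by (simp add: loc_int_def)
      have "loc_int (- {0}) (\<lambda>x. flux p (g x) \<bullet> grad \<eta> x)"
        using cg by (intro loc_int_inner_continuous Fl open_punctured continuous_intros)
      then show "(\<lambda>x. flux p (g x) \<bullet> grad \<eta> x) \<in> borel_measurable ?M"
        by (simp add: loc_int_def)
    qed
    then show "(LINT x|?M. f x * (grad \<eta> x \<bullet> x + 0 * \<eta> x)) = 0"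
      using div[OF test] by simp
  qed
  from this Ff AE_scale[OF Ff less_imp_neq[OF t, symmetric]] show ?thesis
  proof eventually_elim
    fix x assume *: "f (t *\<^sub>R x) = t powr (0 - real DIM('a)) * f x" "flux p (g x) = f x *\<^sub>R x"
      "flux p (g (t *\<^sub>R x)) = f (t *\<^sub>R x) *\<^sub>R t *\<^sub>R x"
    have "flux p (g (t *\<^sub>R x)) = (t powr - real DIM('a) * t) *\<^sub>R flux p (g x)"
      using * by (simp add: ac_simps)
    also have "t powr - real DIM('a) * t = t powr (1 - real DIM('a))"
      using t by (simp add: powr_diff powr_minus field_simps)
    finally have "flux p (g (t *\<^sub>R x)) = t powr (1 - real DIM('a)) *\<^sub>R flux p (g x)" .
    from flux_scaleR_cancel[OF this _ p] t
    show "g (t *\<^sub>R x) = t powr ((1 - real DIM('a)) / (p - 1)) *\<^sub>R g x"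
      by (simp add: powr_powr)
  qed
qed

lemma weak_gradient_scale:
  fixes u :: "'a::euclidean_space \<Rightarrow> real"
  assumes u: "continuous_on (- {0}) u" and g: "loc_int (- {0}) g" and wg: "weak_gradient (- {0}) u g"
    and t: "t > 0"
  shows "weak_gradient (- {0}) (\<lambda>x. u (t *\<^sub>R x)) (\<lambda>x. t *\<^sub>R g (t *\<^sub>R x))"
proof -
  let ?M = "lebesgue_on (- {0 :: 'a})"
  note wgi = wg[unfolded weak_gradient_iff[OF open_punctured u g], rule_format]
  have cu: "continuous_on (- {0}) (\<lambda>x. u (t *\<^sub>R x))"
    using t by (intro continuous_on_compose2[OF u] continuous_intros) auto
  have lg: "loc_int (- {0}) (\<lambda>x. t *\<^sub>R g (t *\<^sub>R x))"
    using t by (intro loc_int_scaleR_continuous loc_int_scale g open_punctured continuous_intros) auto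
  show ?thesis
    unfolding weak_gradient_iff[OF open_punctured cu lg]
  proof (intro allI impI)
    fix \<eta> and v :: 'a assume test: "test_function (- {0 :: 'a}) \<eta>"
    define s where "s = inverse t"
    have s: "s > 0" "s * t = 1" using t by (auto simp: s_def)
    define \<eta>' where "\<eta>' x = \<eta> (s *\<^sub>R x)" for x
    have test': "test_function (- {0}) \<eta>'"
      unfolding \<eta>'_def using s by (intro test_function_dilate test) auto
    have gr: "grad \<eta>' x = s *\<^sub>R grad \<eta> (s *\<^sub>R x)" for x
      unfolding \<eta>'_def
      by (intro grad_eqI, rule has_derivative_eq_rhs, rule has_derivative_compose[OF _ test_has_derivative[OF test]])
         (auto intro!: derivative_eq_intros)
    have cg: "continuous_on (- {0}) (grad \<eta>')"
      using test_continuous(2)[OF test'] by (auto intro: continuous_on_subset)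
    have ce: "continuous_on (- {0}) \<eta>'"
      using test_continuous(1)[OF test'] by (auto intro: continuous_on_subset)
    have "loc_int (- {0}) (\<lambda>x. u x * (grad \<eta>' x \<bullet> v))"
      using cg u by (intro loc_int_continuous open_punctured continuous_intros)
    then have m1: "(\<lambda>x. u x * (grad \<eta>' x \<bullet> v)) \<in> borel_measurable ?M" by (simp add: loc_int_def)
    have "loc_int (- {0}) (\<lambda>x. (g x \<bullet> v) * \<eta>' x)"
      using ce by (intro loc_int_mult_continuous loc_int_inner_continuous g open_punctured continuous_intros)
    then have m2: "(\<lambda>x. \<eta>' x * (g x \<bullet> v)) \<in> borel_measurable ?M" by (simp add: loc_int_def mult.commute)
    have st: "s *\<^sub>R t *\<^sub>R x = x" for x :: 'a using s by simp
    have "t ^ DIM('a) * (s * (LINT x|?M. u (t *\<^sub>R x) * (grad \<eta> x \<bullet> v))) =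
        t ^ DIM('a) * (LINT x|?M. u (t *\<^sub>R x) * (grad \<eta>' (t *\<^sub>R x) \<bullet> v))"
      by (simp only: gr st) (simp add: mult.left_commute)
    also have "\<dots> = (LINT x|?M. u x * (grad \<eta>' x \<bullet> v))"
      by (rule punctured_integral[OF m1 t, symmetric])
    also have "\<dots> = - (LINT x|?M. \<eta>' x * (g x \<bullet> v))"
      by (rule wgi[OF test'])
    also have "\<dots> = - (t ^ DIM('a) * (LINT x|?M. \<eta>' (t *\<^sub>R x) * (g (t *\<^sub>R x) \<bullet> v)))"
      by (simp only: punctured_integral[OF m2 t])
    also have "\<dots> = t ^ DIM('a) * - (LINT x|?M. \<eta> x * (g (t *\<^sub>R x) \<bullet> v))"
      by (simp add: \<eta>'_def s)
    finally have eq: "t ^ DIM('a) * (s * (LINT x|?M. u (t *\<^sub>R x) * (grad \<eta> x \<bullet> v)))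
        = t ^ DIM('a) * - (LINT x|?M. \<eta> x * (g (t *\<^sub>R x) \<bullet> v))" .
    have "t ^ DIM('a) \<noteq> 0" using t by simp
    from eq[unfolded mult_left_cancel[OF this]]
    have "s * (LINT x|?M. u (t *\<^sub>R x) * (grad \<eta> x \<bullet> v)) = - (LINT x|?M. \<eta> x * (g (t *\<^sub>R x) \<bullet> v))" .
    then have "t * s * (LINT x|?M. u (t *\<^sub>R x) * (grad \<eta> x \<bullet> v)) = t * - (LINT x|?M. \<eta> x * (g (t *\<^sub>R x) \<bullet> v))"
      by (simp only: mult.assoc)
    then show "(LINT x|?M. u (t *\<^sub>R x) * (grad \<eta> x \<bullet> v)) = - (LINT x|?M. \<eta> x * (t *\<^sub>R g (t *\<^sub>R x) \<bullet> v))"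
      using t by (simp add: s_def mult.left_commute)
  qed
qed

lemma continuous_AE_zero:
  fixes d :: "'a::euclidean_space \<Rightarrow> real"
  assumes "open G" "continuous_on G d" "AE x in lebesgue. x \<in> G \<longrightarrow> d x = 0" "x \<in> G"
  shows "d x = 0"
proof (rule ccontr)
  assume "d x \<noteq> 0"
  let ?S = "{x \<in> G. d x \<noteq> 0}"
  have "open (G \<inter> d -` (- {0}))"
    using assms(1,2) by (intro continuous_open_preimage) auto
  moreover have "G \<inter> d -` (- {0}) = ?S" by auto
  ultimately have "open ?S" by simp
  moreover have "AE x \<in> ?S in lebesgue. x \<in> {}"
    using assms(3) by eventually_elim auto
  ultimately show False
    using mem_closed_if_AE_lebesgue_open[of ?S "{}" x] assms(4) \<open>d x \<noteq> 0\<close> by simp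
qed

text \<open>A vanishing weak gradient gives \<open>\<integral> K div(\<eta> x) = 0\<close>, that is, weak homogeneity of degree zero. So \<open>K\<close> is
  constant along rays, and rays reach every radius.\<close>

lemma weak_gradient_zero_radial_constant:
  fixes K :: "real \<Rightarrow> real"
  assumes k: "continuous_on (- {0 :: 'a::euclidean_space}) (\<lambda>x. K (norm x))"
    and wg: "weak_gradient (- {0 :: 'a}) (\<lambda>x. K (norm x)) (\<lambda>_. 0)" and r: "r > 0"
  shows "K r = K 1"
proof -
  let ?M = "lebesgue_on (- {0 :: 'a})"
  have l0: "loc_int (- {0 :: 'a}) (\<lambda>_. 0 :: 'a)"
    by (intro loc_int_continuous open_punctured continuous_intros)
  have lk: "loc_int (- {0 :: 'a}) (\<lambda>x. K (norm x))"
    by (rule loc_int_continuous[OF open_punctured k])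
  note wgi = wg[unfolded weak_gradient_iff[OF open_punctured k l0], rule_format]
  have AE: "AE x in lebesgue. K (norm (r *\<^sub>R x)) = r powr (real DIM('a) - real DIM('a)) * K (norm (x :: 'a))"
  proof (rule weakly_homogeneous_imp_homogeneous[OF lk r])
    fix \<eta> assume t: "test_function (- {0 :: 'a}) \<eta>"
    have ik: "integrable ?M (\<lambda>x. K (norm x) * (grad (\<lambda>x. (x \<bullet> b) * \<eta> x) x \<bullet> c))" for b c
      using test_grad_integrable[OF loc_int_continuous[OF open_punctured] open_punctured test_inner_mult[OF t, of b],
          of "\<lambda>x. K (norm x) *\<^sub>R c"] k
      by (simp add: inner_commute continuous_intros)
    have "grad \<eta> x \<bullet> x + DIM('a) * \<eta> x = (\<Sum>b\<in>Basis. grad (\<lambda>x. (x \<bullet> b) * \<eta> x) x \<bullet> b)" for x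
      unfolding grad_inner_mult[OF t]
      by (simp add: inner_add_left sum.distrib euclidean_inner[of "grad \<eta> x" x] mult.commute)
    then have "(LINT x|?M. K (norm x) * (grad \<eta> x \<bullet> x + DIM('a) * \<eta> x))
        = (\<Sum>b\<in>Basis. LINT x|?M. K (norm x) * (grad (\<lambda>x. (x \<bullet> b) * \<eta> x) x \<bullet> b))"
      using ik by (simp add: sum_distrib_left)
    also have "\<dots> = 0"
      using wgi[OF test_inner_mult[OF t]] by simp
    finally show "(LINT x|?M. K (norm x) * (grad \<eta> x \<bullet> x + DIM('a) * \<eta> x)) = 0" .
  qed
  obtain i :: 'a where i: "i \<in> Basis" using nonempty_Basis by blast
  have "K (norm (r *\<^sub>R i)) - K (norm i) = 0"
  proof (rule continuous_AE_zero[OF open_punctured, where d="\<lambda>x. K (norm (r *\<^sub>R x)) - K (norm x)"])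
    show "continuous_on (- {0 :: 'a}) (\<lambda>x. K (norm (r *\<^sub>R x)) - K (norm x))"
      using r by (intro continuous_on_diff k continuous_on_compose2[OF k, where f="\<lambda>x. r *\<^sub>R x"] continuous_intros) auto
    show "AE x in lebesgue. x \<in> - {0 :: 'a} \<longrightarrow> K (norm (r *\<^sub>R x)) - K (norm x) = 0"
      using AE r by (auto elim!: eventually_mono)
  qed (use i in auto)
  then show ?thesis using i r by simp
qed

text \<open>Both \<open>t g(t x)\<close> and \<open>t\<^sup>\<beta> g(x)\<close> are almost everywhere equal by homogeneity, and they are the weak
  gradients of \<open>\<rho>(t |x|)\<close> and \<open>t\<^sup>\<beta> \<rho>(|x|)\<close>. The difference of these two functions is therefore constant,
  which is the functional equation \<open>const\<close>. Comparing it with its mirror image under the exchange of \<open>t\<close>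
  and \<open>r\<close>, with one of them set to \<open>2\<close>, determines \<open>\<rho>\<close>.\<close>

theorem radial_p_harmonic:
  fixes \<rho> :: "real \<Rightarrow> real"
  assumes ph: "p_harmonic p (- {0 :: 'a::euclidean_space}) (\<lambda>x. \<rho> (norm x))"
    and p: "p > 1" "p \<noteq> DIM('a)"
  shows "\<exists>A B. \<forall>r>0. \<rho> r = A * r powr ((p - DIM('a)) / (p - 1)) + B"
proof -
  let ?M = "lebesgue_on (- {0 :: 'a})"
  define \<beta> where "\<beta> = (p - DIM('a)) / (p - 1)"
  from ph obtain g where w: "continuous_on (- {0 :: 'a}) (\<lambda>x. \<rho> (norm x))"
    and g: "Lp_loc p (- {0}) g" and wg: "weak_gradient (- {0 :: 'a}) (\<lambda>x. \<rho> (norm x)) g"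
    and div: "\<And>\<eta>. test_function (- {0 :: 'a}) \<eta> \<Longrightarrow> (LINT x|?M. flux p (g x) \<bullet> grad \<eta> x) = 0"
    unfolding p_harmonic_def flux_def by blast
  have gl: "loc_int (- {0}) g"
    using Lp_loc_imp_loc_int[OF g open_punctured] p by simp
  note wgi = wg[unfolded weak_gradient_iff[OF open_punctured w gl], rule_format]
  have const: "\<rho> (t * r) - t powr \<beta> * \<rho> r = \<rho> t - t powr \<beta> * \<rho> 1" if t: "t > 0" and r: "r > 0" for t r
  proof -
    define K where "K r = \<rho> (t * r) - t powr \<beta> * \<rho> r" for r
    have wt: "continuous_on (- {0 :: 'a}) (\<lambda>x. \<rho> (norm (t *\<^sub>R x)))"
      using t by (intro continuous_on_compose2[OF w, where f="\<lambda>x. t *\<^sub>R x"] continuous_intros) auto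
    have Kn: "K (norm x) = \<rho> (norm (t *\<^sub>R x)) - t powr \<beta> * \<rho> (norm x)" for x :: 'a
      using t by (simp add: K_def)
    have kc: "continuous_on (- {0 :: 'a}) (\<lambda>x. K (norm x))"
      unfolding Kn by (intro continuous_intros wt w)
    have lgt: "loc_int (- {0}) (\<lambda>x. t *\<^sub>R g (t *\<^sub>R x))"
      using t by (intro loc_int_scaleR_continuous loc_int_scale gl open_punctured continuous_intros) auto
    note wgt = weak_gradient_scale[OF w gl wg t, unfolded weak_gradient_iff[OF open_punctured wt lgt], rule_format]
    have l0: "loc_int (- {0 :: 'a}) (\<lambda>_. 0 :: 'a)"
      by (intro loc_int_continuous open_punctured continuous_intros)
    have "(1 - real DIM('a)) / (p - 1) + 1 = \<beta>"
      using p by (simp add: \<beta>_def field_simps)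
    then have "t * t powr ((1 - real DIM('a)) / (p - 1)) = t powr \<beta>"
      using t by (metis mult.commute powr_add powr_one less_imp_le)
    then have AEg: "AE x in lebesgue. t *\<^sub>R g (t *\<^sub>R x) = t powr \<beta> *\<^sub>R g x"
      using radial_p_harmonic_gradient_homogeneous[OF w p(1) g wg div t] by (auto elim!: eventually_mono)
    have "weak_gradient (- {0 :: 'a}) (\<lambda>x. K (norm x)) (\<lambda>_. 0)"
      unfolding weak_gradient_iff[OF open_punctured kc l0]
    proof (intro allI impI)
      fix \<eta> and v :: 'a assume test: "test_function (- {0 :: 'a}) \<eta>"
      have iw: "integrable ?M (\<lambda>x. u x * (grad \<eta> x \<bullet> v))" if "continuous_on (- {0}) u" for u
        using test_grad_integrable[OF loc_int_continuous[OF open_punctured] open_punctured test, of "\<lambda>x. u x *\<^sub>R v"] that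
        by (simp add: inner_commute continuous_intros)
      have ig: "integrable ?M (\<lambda>x. \<eta> x * (h x \<bullet> v))" if "loc_int (- {0}) h" for h
        using test_integrable[OF loc_int_inner_continuous[OF that open_punctured] open_punctured test, of "\<lambda>_. v"]
        by (simp add: mult.commute)
      have "(LINT x|?M. K (norm x) * (grad \<eta> x \<bullet> v)) = (LINT x|?M. \<rho> (norm (t *\<^sub>R x)) * (grad \<eta> x \<bullet> v))
          - t powr \<beta> * (LINT x|?M. \<rho> (norm x) * (grad \<eta> x \<bullet> v))"
        unfolding Kn using iw[OF wt] iw[OF w] by (simp add: left_diff_distrib mult.assoc)
      also have "\<dots> = t powr \<beta> * (LINT x|?M. \<eta> x * (g x \<bullet> v)) - (LINT x|?M. \<eta> x * (t *\<^sub>R g (t *\<^sub>R x) \<bullet> v))"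
        unfolding wgt[OF test] wgi[OF test] by simp
      also have "(LINT x|?M. \<eta> x * (t *\<^sub>R g (t *\<^sub>R x) \<bullet> v)) = (LINT x|?M. t powr \<beta> * (\<eta> x * (g x \<bullet> v)))"
      proof (rule integral_cong_AE)
        show "AE x in ?M. \<eta> x * (t *\<^sub>R g (t *\<^sub>R x) \<bullet> v) = t powr \<beta> * (\<eta> x * (g x \<bullet> v))"
          unfolding AE_punctured using AEg by eventually_elim simp
      qed (use ig[OF lgt] ig[OF gl] in \<open>auto intro!: borel_measurable_integrable\<close>)
      finally show "(LINT x|?M. K (norm x) * (grad \<eta> x \<bullet> v)) = - (LINT x|?M. \<eta> x * ((0 :: 'a) \<bullet> v))"
        by simp
    qed
    from weak_gradient_zero_radial_constant[OF kc this r] show ?thesis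
      by (simp add: K_def)
  qed
  define c where "c = (2 :: real) powr \<beta>"
  have "\<beta> \<noteq> 0" using p by (simp add: \<beta>_def)
  then have c: "c \<noteq> 1" by (simp add: c_def powr_def)
  show ?thesis
  proof (intro exI allI impI)
    fix r :: real assume r: "r > 0"
    have "\<rho> r * (1 - c) = \<rho> 2 * (1 - r powr \<beta>) + (r powr \<beta> - c) * \<rho> 1"
      using const[of r 2] const[of 2 r] r by (simp add: c_def algebra_simps)
    then have "\<rho> r = (\<rho> 2 * (1 - r powr \<beta>) + (r powr \<beta> - c) * \<rho> 1) / (1 - c)"
      using c by (simp add: field_simps)
    then show "\<rho> r = ((\<rho> 1 - \<rho> 2) / (1 - c)) * r powr ((p - DIM('a)) / (p - 1)) + (\<rho> 2 - c * \<rho> 1) / (1 - c)"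
      by (simp add: \<beta>_def[symmetric] add_divide_distrib[symmetric] algebra_simps)
  qed
qed

section \<open>Classical p-harmonic functions\<close>

lemma divergence_theorem_test:
  fixes J :: "'a::euclidean_space \<Rightarrow> 'a"
  assumes G: "open G" and t: "test_function G \<eta>"
    and d: "\<And>x. x \<in> G \<Longrightarrow> (J has_derivative J' x) (at x)"
    and c: "\<And>h. continuous_on G (\<lambda>x. J' x h)"
  shows "(LINT x|lebesgue_on G. J x \<bullet> grad \<eta> x) = - (LINT x|lebesgue_on G. \<eta> x * (\<Sum>b\<in>Basis. J' x b \<bullet> b))"
proof -
  let ?M = "lebesgue_on G"
  have cJ: "continuous_on G J"
    using d by (meson continuous_at_imp_continuous_on has_derivative_continuous)
  have comp: "(LINT x|?M. (J x \<bullet> b) * (grad \<eta> x \<bullet> b)) = - (LINT x|?M. \<eta> x * (J' x b \<bullet> b))"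
    if b: "b \<in> Basis" for b
  proof -
    define F where "F x = (\<Sum>i\<in>Basis. (J' x i \<bullet> b) *\<^sub>R i)" for x
    have F: "F x \<bullet> h = J' x h \<bullet> b" if "x \<in> G" for x h
    proof -
      have lin: "linear (J' x)" using d[OF that] has_derivative_linear by blast
      have "J' x h \<bullet> b = J' x (\<Sum>i\<in>Basis. (h \<bullet> i) *\<^sub>R i) \<bullet> b" by (simp add: euclidean_representation)
      also have "\<dots> = F x \<bullet> h"
        unfolding linear_sum[OF lin] linear_scale[OF lin]
        by (simp add: F_def inner_sum_left inner_sum_right inner_commute[of _ h] mult.commute)
      finally show ?thesis ..
    qed
    have "((\<lambda>x. J x \<bullet> b) has_derivative (\<lambda>h. F x \<bullet> h)) (at x)" if "x \<in> G" for x
      unfolding F[OF that] by (rule has_derivative_inner_left[OF d[OF that]])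
    moreover have "continuous_on G F"
      unfolding F_def by (intro continuous_intros c)
    ultimately have "(LINT x|?M. (J x \<bullet> b) * (grad \<eta> x \<bullet> b)) = - (LINT x|?M. \<eta> x * (F x \<bullet> b))"
      by (rule integration_by_parts[OF G t])
    also have "(LINT x|?M. \<eta> x * (F x \<bullet> b)) = (LINT x|?M. \<eta> x * (J' x b \<bullet> b))"
      by (intro Bochner_Integration.integral_cong) (auto simp: F space_restrict_space)
    finally show ?thesis .
  qed
  have i1: "integrable ?M (\<lambda>x. (J x \<bullet> b) * (grad \<eta> x \<bullet> b))" for b
    using test_grad_integrable[OF loc_int_continuous[OF G] G t, of "\<lambda>x. (J x \<bullet> b) *\<^sub>R b"] cJ
    by (simp add: inner_commute continuous_intros)
  have i2: "integrable ?M (\<lambda>x. \<eta> x * (J' x b \<bullet> b))" for b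
    using test_integrable[OF loc_int_continuous[OF G] G t, of "\<lambda>x. J' x b \<bullet> b"] c
    by (simp add: mult.commute continuous_intros)
  have "(LINT x|?M. J x \<bullet> grad \<eta> x) = (\<Sum>b\<in>Basis. LINT x|?M. (J x \<bullet> b) * (grad \<eta> x \<bullet> b))"
    using i1 by (simp add: euclidean_inner[of "J _" "grad \<eta> _"])
  also have "\<dots> = - (LINT x|?M. \<eta> x * (\<Sum>b\<in>Basis. J' x b \<bullet> b))"
    using i2 by (simp add: comp sum_distrib_left sum_negf)
  finally show ?thesis .
qed

text \<open>The flux is described by a separate function \<open>J\<close>, since it is differentiated in closed form, and only
  on \<open>G\<close> does it agree with that form.\<close>

lemma classical_p_harmonic:
  fixes u :: "'a::euclidean_space \<Rightarrow> real"
  assumes G: "open G" and p: "p > 1"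
    and u: "\<And>x. x \<in> G \<Longrightarrow> (u has_derivative (\<lambda>h. F x \<bullet> h)) (at x)" and F: "continuous_on G F"
    and J: "\<And>x. x \<in> G \<Longrightarrow> flux p (F x) = J x"
    and d: "\<And>x. x \<in> G \<Longrightarrow> (J has_derivative J' x) (at x)"
    and c: "\<And>h. continuous_on G (\<lambda>x. J' x h)"
    and div: "\<And>x. x \<in> G \<Longrightarrow> (\<Sum>b\<in>Basis. J' x b \<bullet> b) = 0"
  shows "p_harmonic p G u"
proof -
  let ?M = "lebesgue_on G"
  have cu: "continuous_on G u"
    using u by (meson continuous_at_imp_continuous_on has_derivative_continuous)
  have "(LINT x|?M. (norm (F x) powr (p - 2) *\<^sub>R F x) \<bullet> grad \<eta> x) = 0" if t: "test_function G \<eta>" for \<eta>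
  proof -
    have "(LINT x|?M. (norm (F x) powr (p - 2) *\<^sub>R F x) \<bullet> grad \<eta> x) = (LINT x|?M. J x \<bullet> grad \<eta> x)"
      by (intro Bochner_Integration.integral_cong) (auto simp: J[symmetric] flux_def space_restrict_space)
    also have "\<dots> = - (LINT x|?M. \<eta> x * (\<Sum>b\<in>Basis. J' x b \<bullet> b))"
      by (rule divergence_theorem_test[OF G t d c])
    also have "(LINT x|?M. \<eta> x * (\<Sum>b\<in>Basis. J' x b \<bullet> b)) = (LINT x|?M. 0)"
      by (intro Bochner_Integration.integral_cong) (auto simp: div space_restrict_space)
    finally show ?thesis by simp
  qed
  moreover have "weak_gradient G u F"
    by (rule classical_weak_gradient[OF G u F])
  moreover have "Lp_loc p G u" "Lp_loc p G F"
    using p by (intro Lp_loc_continuous G cu F; simp)+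
  ultimately show ?thesis
    unfolding p_harmonic_def using cu by blast
qed

lemma p_harmonic_affine:
  assumes "open G" "p > 1"
  shows "p_harmonic p G (\<lambda>x :: 'a::euclidean_space. x \<bullet> v + c)"
  by (rule classical_p_harmonic[OF assms, where F="\<lambda>_. v" and J="\<lambda>_. flux p v" and J'="\<lambda>_ _. 0"])
     (auto intro!: derivative_eq_intros continuous_intros simp: inner_commute)

lemma has_derivative_square_powr:
  fixes x :: "'a::euclidean_space"
  assumes "x \<noteq> 0"
  shows "((\<lambda>x. (x \<bullet> x) powr a) has_derivative (\<lambda>h. (2 * a * (x \<bullet> x) powr (a - 1)) * (x \<bullet> h))) (at x)"
proof -
  have "((\<lambda>s. s powr a) has_real_derivative a * (x \<bullet> x) powr (a - 1)) (at (x \<bullet> x))"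
    using assms by (intro has_real_derivative_powr) simp
  then show ?thesis
    unfolding has_field_derivative_def
    by (rule has_derivative_eq_rhs[OF has_derivative_compose, rotated])
       (auto intro!: derivative_eq_intros simp: fun_eq_iff inner_commute)
qed

lemma square_powr: "((x :: 'a::euclidean_space) \<bullet> x) powr a = norm x powr (2 * a)"
proof (cases "x = 0")
  case False
  then have "x \<bullet> x = norm x powr 2"
    by (simp add: power2_norm_eq_inner)
  then show ?thesis by (simp only: powr_powr)
qed simp

text \<open>Powers of \<open>x \<bullet> x\<close> are easier to differentiate than powers of the norm. The exponent \<open>\<beta>\<close> is the one for
  which the flux is a multiple of \<open>x / |x|\<^sup>n\<close>, a field without divergence.\<close>

lemma p_harmonic_fundamental_solution:
  fixes p :: real
  assumes p: "p > 1"
  defines "\<beta> \<equiv> (p - real DIM('a)) / (p - 1)"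
  shows "p_harmonic p (- {0 :: 'a::euclidean_space}) (\<lambda>x. (x \<bullet> x) powr (\<beta> / 2))"
proof -
  define n where "n = real DIM('a)"
  define c where "c = \<bar>\<beta>\<bar> powr (p - 2) * \<beta>"
  show ?thesis
  proof (rule classical_p_harmonic[OF open_punctured p])
    show "((\<lambda>x. (x \<bullet> x) powr (\<beta> / 2)) has_derivative (\<lambda>h. ((\<beta> * (x \<bullet> x) powr (\<beta> / 2 - 1)) *\<^sub>R x) \<bullet> h)) (at x)"
      if "x \<in> - {0}" for x :: 'a
      using has_derivative_square_powr[of x "\<beta> / 2"] that by simp
    show "continuous_on (- {0}) (\<lambda>x :: 'a. (\<beta> * (x \<bullet> x) powr (\<beta> / 2 - 1)) *\<^sub>R x)"
      by (intro continuous_intros) auto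
    show "flux p ((\<beta> * (x \<bullet> x) powr (\<beta> / 2 - 1)) *\<^sub>R x) = c *\<^sub>R ((x \<bullet> x) powr (- n / 2) *\<^sub>R x)"
      if "x \<in> - {0}" for x :: 'a
    proof -
      have x: "norm x > 0" using that by simp
      have "norm ((\<beta> * (x \<bullet> x) powr (\<beta> / 2 - 1)) *\<^sub>R x) = \<bar>\<beta>\<bar> * norm x powr (\<beta> - 1)"
        using x powr_add[of "norm x" "\<beta> - 2" 1] by (simp add: square_powr abs_mult)
      then have "flux p ((\<beta> * (x \<bullet> x) powr (\<beta> / 2 - 1)) *\<^sub>R x) =
          (\<bar>\<beta>\<bar> powr (p - 2) * \<beta> * (norm x powr ((\<beta> - 1) * (p - 2)) * norm x powr (\<beta> - 2))) *\<^sub>R x"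
        by (simp add: flux_def powr_mult powr_powr square_powr ac_simps)
      also have "norm x powr ((\<beta> - 1) * (p - 2)) * norm x powr (\<beta> - 2) = norm x powr ((\<beta> - 1) * (p - 2) + (\<beta> - 2))"
        by (simp add: powr_add)
      also have "(\<beta> - 1) * (p - 2) + (\<beta> - 2) = - n"
      proof -
        have "\<beta> * (p - 1) = p - n" using p by (simp add: \<beta>_def n_def)
        then show ?thesis by (simp add: algebra_simps)
      qed
      finally show ?thesis by (simp add: c_def square_powr)
    qed
    show "((\<lambda>x. c *\<^sub>R ((x \<bullet> x) powr (- n / 2) *\<^sub>R x)) has_derivative
        (\<lambda>h. c *\<^sub>R ((x \<bullet> x) powr (- n / 2) *\<^sub>R h - (n * (x \<bullet> x) powr (- n / 2 - 1) * (x \<bullet> h)) *\<^sub>R x))) (at x)"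
      if "x \<in> - {0}" for x :: 'a
      using that
      by (intro has_derivative_scaleR_right, intro has_derivative_eq_rhs[OF
          has_derivative_scaleR[OF has_derivative_square_powr[of x] has_derivative_ident]]) auto
    show "continuous_on (- {0}) (\<lambda>x. c *\<^sub>R ((x \<bullet> x) powr (- n / 2) *\<^sub>R h - (n * (x \<bullet> x) powr (- n / 2 - 1) * (x \<bullet> h)) *\<^sub>R x))"
      for h :: 'a
      by (intro continuous_intros) auto
    show "(\<Sum>b\<in>Basis. (c *\<^sub>R ((x \<bullet> x) powr (- n / 2) *\<^sub>R b - (n * (x \<bullet> x) powr (- n / 2 - 1) * (x \<bullet> b)) *\<^sub>R x)) \<bullet> b) = 0"
      if "x \<in> - {0}" for x :: 'a
    proof -
      have "(\<Sum>b\<in>Basis. (c *\<^sub>R ((x \<bullet> x) powr (- n / 2) *\<^sub>R b - (n * (x \<bullet> x) powr (- n / 2 - 1) * (x \<bullet> b)) *\<^sub>R x)) \<bullet> b)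
          = (\<Sum>b\<in>Basis. c * (x \<bullet> x) powr (- n / 2) - c * n * (x \<bullet> x) powr (- n / 2 - 1) * ((x \<bullet> b) * (x \<bullet> b)))"
        by (intro sum.cong refl) (simp add: inner_diff_left algebra_simps)
      also have "\<dots> = c * n * (x \<bullet> x) powr (- n / 2) - c * n * ((x \<bullet> x) powr (- n / 2 - 1) * (x \<bullet> x))"
        by (simp add: sum_subtractf sum_distrib_left[symmetric] euclidean_inner[of x x, symmetric] n_def)
      also have "(x \<bullet> x) powr (- n / 2 - 1) * (x \<bullet> x) = (x \<bullet> x) powr (- n / 2)"
        using that by (simp add: powr_diff)
      finally show ?thesis by simp
    qed
  qed
qed

lemma p_harmonic_cong:
  fixes u v :: "'a::euclidean_space \<Rightarrow> real"
  assumes G: "open G" and eq: "\<And>x. x \<in> G \<Longrightarrow> u x = v x" and u: "p_harmonic p G u"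
  shows "p_harmonic p G v"
proof -
  have "continuous_on G v"
    using u eq unfolding p_harmonic_def by (metis continuous_on_cong)
  moreover have "Lp_loc p G v"
    unfolding Lp_loc_def
  proof (intro conjI allI impI)
    show "v \<in> borel_measurable (lebesgue_on G)"
      using u eq unfolding p_harmonic_def Lp_loc_def
      by (metis measurable_lebesgue_cong)
    fix K assume K: "compact K \<and> K \<subseteq> G"
    then have "integrable (lebesgue_on K) (\<lambda>x. norm (u x) powr p)"
      using u unfolding p_harmonic_def Lp_loc_def by blast
    moreover have "integrable (lebesgue_on K) (\<lambda>x. norm (u x) powr p) = integrable (lebesgue_on K) (\<lambda>x. norm (v x) powr p)"
      using K eq by (intro Bochner_Integration.integrable_cong) (auto simp: space_restrict_space)
    ultimately show "integrable (lebesgue_on K) (\<lambda>x. norm (v x) powr p)" by simp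
  qed
  moreover have "weak_gradient G v g" if "weak_gradient G u g" for g
  proof -
    have "(LINT x|lebesgue_on G. u x *\<^sub>R grad \<eta> x) = (LINT x|lebesgue_on G. v x *\<^sub>R grad \<eta> x)" for \<eta>
      by (intro Bochner_Integration.integral_cong) (auto simp: eq space_restrict_space)
    with that show ?thesis unfolding weak_gradient_def by simp
  qed
  ultimately show ?thesis
    using u unfolding p_harmonic_def by blast
qed

section \<open>The inverted coordinate function\<close>

text \<open>Uniqueness of the weak gradient identifies the unknown \<open>g\<close> in the definition with the classical
  gradient. The weak equation then says that the continuous divergence of \<open>J\<close> annihilates all test
  functions.\<close>

lemma classical_p_harmonic_divergence:
  fixes u :: "'a::euclidean_space \<Rightarrow> real"
  assumes G: "open G" and p: "p > 1" and ph: "p_harmonic p G u"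
    and u: "\<And>x. x \<in> G \<Longrightarrow> (u has_derivative (\<lambda>h. F x \<bullet> h)) (at x)" and F: "continuous_on G F"
    and J: "\<And>x. x \<in> G \<Longrightarrow> flux p (F x) = J x"
    and d: "\<And>x. x \<in> G \<Longrightarrow> (J has_derivative J' x) (at x)"
    and c: "\<And>h. continuous_on G (\<lambda>x. J' x h)" and x: "x \<in> G"
  shows "(\<Sum>b\<in>Basis. J' x b \<bullet> b) = 0"
proof -
  let ?M = "lebesgue_on G"
  define D where "D x = (\<Sum>b\<in>Basis. J' x b \<bullet> b)" for x
  have cD: "continuous_on G D" unfolding D_def by (intro continuous_intros c)
  have cJ: "continuous_on G J"
    using d by (meson continuous_at_imp_continuous_on has_derivative_continuous)
  from ph obtain g where cu: "continuous_on G u"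
    and g: "Lp_loc p G g" and wg: "weak_gradient G u g"
    and div: "\<And>\<eta>. test_function G \<eta> \<Longrightarrow> (LINT x|?M. flux p (g x) \<bullet> grad \<eta> x) = 0"
    unfolding p_harmonic_def flux_def by blast
  have gl: "loc_int G g"
    using Lp_loc_imp_loc_int[OF g G] p by simp
  have gF: "AE x in ?M. g x = F x"
    by (rule weak_gradient_unique[OF G cu gl loc_int_continuous[OF G F] wg classical_weak_gradient[OF G u F]])
  have "AE x in ?M. D x = 0"
  proof (rule fundamental_lemma[OF loc_int_continuous[OF G cD] G])
    fix \<eta> assume t: "test_function G \<eta>"
    have "(LINT x|?M. flux p (g x) \<bullet> grad \<eta> x) = (LINT x|?M. J x \<bullet> grad \<eta> x)"
    proof (rule integral_cong_AE)
      have "AE x in ?M. x \<in> G" by (intro AE_I2) (simp add: space_restrict_space)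
      with gF show "AE x in ?M. flux p (g x) \<bullet> grad \<eta> x = J x \<bullet> grad \<eta> x"
        by eventually_elim (simp add: J)
      have cg: "continuous_on G (grad \<eta>)"
        using test_continuous(2)[OF t] by (auto intro: continuous_on_subset)
      have "loc_int G (\<lambda>x. flux p (g x) \<bullet> grad \<eta> x)"
        using cg p by (intro loc_int_inner_continuous G Lp_loc_imp_loc_int_flux[OF g]) auto
      moreover have "loc_int G (\<lambda>x. J x \<bullet> grad \<eta> x)"
        using cg cJ by (intro loc_int_continuous G continuous_intros)
      ultimately show "(\<lambda>x. flux p (g x) \<bullet> grad \<eta> x) \<in> borel_measurable ?M" "(\<lambda>x. J x \<bullet> grad \<eta> x) \<in> borel_measurable ?M"
        by (auto simp: loc_int_def)
    qed
    then have "(LINT x|?M. J x \<bullet> grad \<eta> x) = 0" using div[OF t] by simp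
    then show "(LINT x|?M. D x * \<eta> x) = 0"
      using divergence_theorem_test[OF G t d c] by (simp add: D_def mult.commute)
  qed
  then have "AE x in lebesgue. x \<in> G \<longrightarrow> D x = 0"
    using G by (subst (asm) AE_restrict_space_iff) (auto simp: sets_lebesgue_open)
  from continuous_AE_zero[OF G cD this x] show ?thesis by (simp add: D_def)
qed

text \<open>The bracket that occurs in the divergence of the flux below, with \<open>s = |x|\<^sup>2\<close> and \<open>q = (x \<bullet> e)\<^sup>2\<close>. It
  vanishes for \<open>q = s\<close>, so evaluating the equation on the axis through \<open>e\<close> would not give a contradiction.\<close>

lemma inverted_coordinate_divergence:
  fixes n \<gamma> p s q P a b \<kappa> :: real
  assumes \<gamma>: "\<gamma> * (p - 1) = 2 - n - p" and \<kappa>: "\<kappa> = \<gamma> * \<gamma> + 2 * \<gamma>" and P: "P = s + \<kappa> * q"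
    and a: "2 * a = 2 - n - 2 * p" and b: "2 * b = p - 2"
  shows "2 * a * P * (1 + \<gamma>) + 2 * b * (s * (1 + \<gamma>) + \<kappa> * (s + \<gamma> * q)) + P * (2 + \<gamma> + \<gamma> * n)
    = (p - 2) * \<gamma> * (\<gamma> + 2) * (s - q)"
proof -
  have n: "n = 2 - p - \<gamma> * (p - 1)" using \<gamma> by linarith
  show ?thesis
    unfolding a b P \<kappa> n by (simp add: algebra_simps)
qed

text \<open>The gradient is \<open>A s\<^bsup>\<gamma>/2-1\<^esup> Z\<close> with \<open>s = |x|\<^sup>2\<close> and \<open>Z = s e + \<gamma> (x \<bullet> e) x\<close>, and \<open>|Z|\<^sup>2 = s P\<close>. Since
  \<open>\<gamma> \<noteq> - 1\<close>, the factor \<open>P\<close> is positive off the origin, so the flux \<open>c s\<^sup>a P\<^sup>b Z\<close> is smooth there, also for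
  \<open>p < 2\<close>. The contradiction is read off at \<open>e + e'\<close>, which is neither on the axis through \<open>e\<close> nor orthogonal
  to it.\<close>

lemma inverted_coordinate_not_p_harmonic:
  fixes e e' :: "'a::euclidean_space" and p A \<gamma> :: real
  assumes e: "e \<in> Basis" "e' \<in> Basis" "e \<noteq> e'" and p: "p > 1" "p \<noteq> 2" "p \<noteq> real DIM('a)"
    and A: "A \<noteq> 0"
    and \<gamma>: "\<gamma> = (p - real DIM('a)) / (p - 1) - 2"
  shows "\<not> p_harmonic p (- {0}) (\<lambda>x. A * ((x \<bullet> x) powr (\<gamma> / 2) * (x \<bullet> e)))"
proof
  assume ph: "p_harmonic p (- {0}) (\<lambda>x. A * ((x \<bullet> x) powr (\<gamma> / 2) * (x \<bullet> e)))"
  define n where "n = real DIM('a)"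
  define \<kappa> where "\<kappa> = \<gamma> * \<gamma> + 2 * \<gamma>"
  define a where "a = (2 - n - 2 * p) / 2"
  define b where "b = (p - 2) / 2"
  define P where "P x = x \<bullet> x + \<kappa> * (x \<bullet> e)\<^sup>2" for x
  define Z where "Z x = (x \<bullet> x) *\<^sub>R e + (\<gamma> * (x \<bullet> e)) *\<^sub>R x" for x
  define F where "F x = (A * (x \<bullet> x) powr (\<gamma> / 2 - 1)) *\<^sub>R Z x" for x
  define c where "c = \<bar>A\<bar> powr (p - 2) * A"
  define J where "J x = (c * (x \<bullet> x) powr a * P x powr b) *\<^sub>R Z x" for x
  define J' where "J' x h = (c * (x \<bullet> x) powr a * P x powr b) *\<^sub>R ((2 * (x \<bullet> h)) *\<^sub>R e + (\<gamma> * (x \<bullet> e)) *\<^sub>R h + (\<gamma> * (h \<bullet> e)) *\<^sub>R x)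
     + (c * ((x \<bullet> x) powr a * (b * P x powr (b - 1) * (2 * (x \<bullet> h) + 2 * \<kappa> * (x \<bullet> e) * (h \<bullet> e)))
        + 2 * a * (x \<bullet> x) powr (a - 1) * (x \<bullet> h) * P x powr b)) *\<^sub>R Z x" for x h
  have n2: "n \<ge> 2"
  proof -
    have "card {e, e'} \<le> DIM('a)" using e by (intro card_mono) auto
    then show ?thesis using e by (simp add: n_def)
  qed
  have \<gamma>p: "\<gamma> * (p - 1) = 2 - n - p"
    using p by (simp add: \<gamma> n_def field_simps)
  have \<gamma>1: "\<gamma> + 1 \<noteq> 0"
  proof
    assume "\<gamma> + 1 = 0"
    then have "\<gamma> = - 1" by simp
    then show False using \<gamma>p n2 by simp
  qed
  have \<gamma>0: "\<gamma> \<noteq> 0" using \<gamma>p n2 p by auto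
  have \<gamma>2: "\<gamma> + 2 \<noteq> 0" using p by (simp add: \<gamma>)
  have ee: "e \<bullet> e = 1" using e by (simp add: inner_Basis)
  have xe: "(e + e') \<bullet> e = 1" "(e + e') \<bullet> (e + e') = 2"
    using e by (auto simp: inner_Basis inner_add_left inner_add_right)
  then have x0: "e + e' \<noteq> 0" by auto
  have Ppos: "P x > 0" if "x \<noteq> 0" for x
  proof -
    have "(x \<bullet> e)\<^sup>2 \<le> x \<bullet> x"
      using Cauchy_Schwarz_ineq[of x e] ee by simp
    moreover have "P x = (x \<bullet> x - (x \<bullet> e)\<^sup>2) + (\<gamma> + 1)\<^sup>2 * (x \<bullet> e)\<^sup>2"
      by (simp add: P_def \<kappa>_def power2_eq_square algebra_simps)
    moreover have "(\<gamma> + 1)\<^sup>2 > 0" using \<gamma>1 by simp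
    moreover have "x \<bullet> x > 0" using that by simp
    ultimately show ?thesis
      by (cases "x \<bullet> e = 0") (auto intro: add_nonneg_pos)
  qed
  have ZZ: "Z x \<bullet> Z x = (x \<bullet> x) * P x" for x
    by (simp add: Z_def P_def \<kappa>_def inner_add_left inner_add_right ee inner_commute power2_eq_square algebra_simps)
  have "(\<Sum>i\<in>Basis. J' (e + e') i \<bullet> i) = 0"
  proof (rule classical_p_harmonic_divergence[OF open_punctured p(1) ph])
    show "((\<lambda>x. A * ((x \<bullet> x) powr (\<gamma> / 2) * (x \<bullet> e))) has_derivative (\<bullet>) (F x)) (at x)"
      if "x \<in> - {0}" for x
    proof -
      have x: "x \<bullet> x > 0" using that by simp
      have "(x \<bullet> x) powr (\<gamma> / 2) = (x \<bullet> x) powr (\<gamma> / 2 - 1) * (x \<bullet> x)"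
        using x by (simp add: powr_diff)
      then have "(\<lambda>h. A * ((x \<bullet> x) powr (\<gamma> / 2) * (h \<bullet> e) + 2 * (\<gamma> / 2) * (x \<bullet> x) powr (\<gamma> / 2 - 1) * (x \<bullet> h) * (x \<bullet> e))) = (\<bullet>) (F x)"
        by (auto simp: fun_eq_iff F_def Z_def inner_add_left inner_commute algebra_simps)
      moreover have "((\<lambda>x. A * ((x \<bullet> x) powr (\<gamma> / 2) * (x \<bullet> e))) has_derivative
          (\<lambda>h. A * ((x \<bullet> x) powr (\<gamma> / 2) * (h \<bullet> e) + 2 * (\<gamma> / 2) * (x \<bullet> x) powr (\<gamma> / 2 - 1) * (x \<bullet> h) * (x \<bullet> e)))) (at x)"
        using that by (intro has_derivative_mult_right has_derivative_mult has_derivative_square_powr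
            has_derivative_inner_left has_derivative_ident) auto
      ultimately show ?thesis by simp
    qed
    show "continuous_on (- {0}) F"
      unfolding F_def Z_def by (intro continuous_intros) auto
    show "flux p (F x) = J x" if "x \<in> - {0}" for x
    proof -
      define s where "s = x \<bullet> x"
      have s: "s > 0" and Px: "P x > 0" using that Ppos by (auto simp: s_def)
      have "norm (Z x) = (s * P x) powr (1 / 2)"
        using s Px by (simp add: norm_eq_sqrt_inner ZZ powr_half_sqrt s_def)
      then have nF: "norm (F x) = \<bar>A\<bar> * s powr (\<gamma> / 2 - 1) * (s powr (1 / 2) * P x powr (1 / 2))"
        using s Px by (simp add: F_def abs_mult powr_mult s_def)
      have "norm (F x) powr (p - 2) = \<bar>A\<bar> powr (p - 2) * s powr ((\<gamma> / 2 - 1) * (p - 2)) * (s powr b * P x powr b)"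
        unfolding nF using s Px by (simp add: powr_mult powr_powr b_def)
      then have "flux p (F x) = (\<bar>A\<bar> powr (p - 2) * A * (s powr ((\<gamma> / 2 - 1) * (p - 2)) * s powr b * s powr (\<gamma> / 2 - 1)) * P x powr b) *\<^sub>R Z x"
        by (simp add: flux_def F_def s_def ac_simps)
      also have "s powr ((\<gamma> / 2 - 1) * (p - 2)) * s powr b * s powr (\<gamma> / 2 - 1) = s powr ((\<gamma> / 2 - 1) * (p - 2) + b + (\<gamma> / 2 - 1))"
        by (simp add: powr_add)
      also have "(\<gamma> / 2 - 1) * (p - 2) + b + (\<gamma> / 2 - 1) = a"
      proof -
        have "(\<gamma> / 2 - 1) * (p - 2) + b + (\<gamma> / 2 - 1) = (\<gamma> * (p - 1) - 2 * (p - 1) + (p - 2)) / 2"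
          by (simp add: b_def field_simps)
        then show ?thesis unfolding \<gamma>p by (simp add: a_def)
      qed
      finally show ?thesis by (simp add: J_def c_def s_def)
    qed
    show "(J has_derivative J' x) (at x)" if "x \<in> - {0}" for x
    proof -
      have dP: "(P has_derivative (\<lambda>h. 2 * (x \<bullet> h) + 2 * \<kappa> * (x \<bullet> e) * (h \<bullet> e))) (at x)"
        unfolding P_def by (rule has_derivative_eq_rhs, (rule derivative_intros)+)
          (simp add: fun_eq_iff inner_commute algebra_simps)
      have dZ: "(Z has_derivative (\<lambda>h. (2 * (x \<bullet> h)) *\<^sub>R e + (\<gamma> * (x \<bullet> e)) *\<^sub>R h + (\<gamma> * (h \<bullet> e)) *\<^sub>R x)) (at x)"
        unfolding Z_def by (rule has_derivative_eq_rhs, (rule derivative_intros)+)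
          (simp add: fun_eq_iff inner_commute algebra_simps)
      have "((\<lambda>s. s powr b) has_real_derivative b * P x powr (b - 1)) (at (P x))"
        using Ppos that by (intro has_real_derivative_powr) auto
      from has_derivative_compose[OF dP this[unfolded has_field_derivative_def]]
      have dPb: "((\<lambda>x. P x powr b) has_derivative (\<lambda>h. b * P x powr (b - 1) * (2 * (x \<bullet> h) + 2 * \<kappa> * (x \<bullet> e) * (h \<bullet> e)))) (at x)" .
      have "((\<lambda>x. (x \<bullet> x) powr a) has_derivative (\<lambda>h. 2 * a * (x \<bullet> x) powr (a - 1) * (x \<bullet> h))) (at x)"
        using that by (intro has_derivative_square_powr) simp
      from has_derivative_scaleR[OF has_derivative_mult_right[OF has_derivative_mult[OF this dPb], of c] dZ]
      show ?thesis
        unfolding J_def[abs_def] J'_def[abs_def] by (simp add: mult.assoc)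
    qed
    show "continuous_on (- {0}) (\<lambda>x. J' x h)" for h
    proof -
      have "continuous_on (- {0}) P" unfolding P_def by (intro continuous_intros)
      moreover have "\<forall>x\<in>- {0}. P x \<noteq> 0" using Ppos by force
      ultimately have cP: "continuous_on (- {0}) (\<lambda>x. P x powr r)" for r
        by (intro continuous_on_powr continuous_on_const)
      have cs: "continuous_on (- {0}) (\<lambda>x :: 'a. (x \<bullet> x) powr r)" for r
        by (intro continuous_on_powr continuous_intros) simp
      show ?thesis
        unfolding J'_def Z_def by (intro cP cs continuous_intros)
    qed
    show "e + e' \<in> - {0}"
      using x0 by simp
  qed
  moreover have "(\<Sum>i\<in>Basis. J' x i \<bullet> i) = c * ((x \<bullet> x) powr a * P x powr (b - 1) * (x \<bullet> e) * ((p - 2) * \<gamma> * (\<gamma> + 2) * (x \<bullet> x - (x \<bullet> e)\<^sup>2)))"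
    if "x \<noteq> 0" for x
  proof -
    define s where "s = x \<bullet> x"
    define m where "m = x \<bullet> e"
    have s: "s > 0" and Px: "P x > 0" using that Ppos by (auto simp: s_def)
    define S where "S = c * s powr a * P x powr b"
    define T1 where "T1 = c * (s powr a * (b * P x powr (b - 1)) * 2 + 2 * a * s powr (a - 1) * P x powr b)"
    define T2 where "T2 = c * (s powr a * (b * P x powr (b - 1)) * (2 * \<kappa> * m))"
    have "J' x i \<bullet> i = S * (2 * ((x \<bullet> i) * (e \<bullet> i)) + \<gamma> * m * (i \<bullet> i) + \<gamma> * ((e \<bullet> i) * (x \<bullet> i)))
        + T1 * ((x \<bullet> i) * (Z x \<bullet> i)) + T2 * ((e \<bullet> i) * (Z x \<bullet> i))" for i
      by (simp add: J'_def S_def T1_def T2_def s_def m_def inner_add_left inner_commute[of i e] algebra_simps)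
    then have "(\<Sum>i\<in>Basis. J' x i \<bullet> i) = (\<Sum>i\<in>Basis. S * (2 * ((x \<bullet> i) * (e \<bullet> i)) + \<gamma> * m * (i \<bullet> i) + \<gamma> * ((e \<bullet> i) * (x \<bullet> i)))
        + T1 * ((x \<bullet> i) * (Z x \<bullet> i)) + T2 * ((e \<bullet> i) * (Z x \<bullet> i)))" by simp
    also have "\<dots> = S * (2 * (x \<bullet> e) + \<gamma> * m * n + \<gamma> * (e \<bullet> x)) + T1 * (x \<bullet> Z x) + T2 * (e \<bullet> Z x)"
      by (simp add: sum.distrib sum_distrib_left[symmetric] euclidean_inner[symmetric] n_def inner_Basis)
    also have "\<dots> = S * (m * (2 + \<gamma> + \<gamma> * n)) + T1 * (m * s * (1 + \<gamma>)) + T2 * (s + \<gamma> * m\<^sup>2)"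
      by (simp add: Z_def s_def m_def inner_add_right ee inner_commute power2_eq_square algebra_simps)
    also have "\<dots> = c * (s powr a * P x powr (b - 1) * m *
        (2 * a * P x * (1 + \<gamma>) + 2 * b * (s * (1 + \<gamma>) + \<kappa> * (s + \<gamma> * m\<^sup>2)) + P x * (2 + \<gamma> + \<gamma> * n)))"
    proof -
      define u where "u = s powr (a - 1)"
      define v where "v = P x powr (b - 1)"
      have "s powr a = u * s" "P x powr b = v * P x"
        using s Px by (simp_all add: u_def v_def powr_diff)
      then show ?thesis
        unfolding S_def T1_def T2_def u_def[symmetric] v_def[symmetric]
        by (simp add: algebra_simps)
    qed
    also have "2 * a * P x * (1 + \<gamma>) + 2 * b * (s * (1 + \<gamma>) + \<kappa> * (s + \<gamma> * m\<^sup>2)) + P x * (2 + \<gamma> + \<gamma> * n)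
        = (p - 2) * \<gamma> * (\<gamma> + 2) * (s - m\<^sup>2)"
      by (rule inverted_coordinate_divergence[OF \<gamma>p \<kappa>_def]) (auto simp: P_def s_def m_def a_def b_def)
    finally show ?thesis by (simp add: s_def m_def)
  qed
  moreover have "P (e + e') > 0" by (rule Ppos[OF x0])
  ultimately show False
    using p \<gamma>0 \<gamma>2 A x0 xe by (auto simp: c_def)
qed

section \<open>Multipliers for the inversion\<close>

lemma inversion_facts:
  fixes x :: "'a::euclidean_space"
  shows "inversion x = 0 \<longleftrightarrow> x = 0"
    and "inversion x \<bullet> inversion x = inverse (x \<bullet> x)"
    and "inversion x \<bullet> v = (x \<bullet> v) / (x \<bullet> x)"
  by (auto simp: inversion_def power2_norm_eq_inner field_simps)

lemma reflected_UNIV: "reflected UNIV = - {0}"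
  and reflected_punctured: "reflected (- {0}) = - {0}"
  by (auto simp: reflected_def inversion_facts)

theorem no_kelvin_transform:
  fixes \<rho> :: "real \<Rightarrow> real" and p :: real
  assumes n: "DIM('a::euclidean_space) \<ge> 2" and p: "1 < p" "p \<noteq> 2" "p \<noteq> real DIM('a)"
    and nz: "r0 > 0" "\<rho> r0 \<noteq> 0"
    and transform: "\<And>(G :: 'a set) u. open G \<Longrightarrow> connected G \<Longrightarrow> G \<noteq> {} \<Longrightarrow> p_harmonic p G u \<Longrightarrow>
      p_harmonic p (reflected G) (\<lambda>x. \<rho> (norm x) * u (inversion x))"
  shows False
proof -
  define \<beta> where "\<beta> = (p - real DIM('a)) / (p - 1)"
  have \<beta>: "\<beta> \<noteq> 0" using p by (simp add: \<beta>_def)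
  obtain e e' :: 'a where e: "e \<in> Basis" "e' \<in> Basis" "e \<noteq> e'"
    using n card_le_Suc0_iff_eq[of "Basis :: 'a set"] by fastforce
  have "p_harmonic p (reflected UNIV) (\<lambda>x :: 'a. \<rho> (norm x) * (inversion x \<bullet> 0 + 1))"
    using p by (intro transform p_harmonic_affine) auto
  then have "p_harmonic p (- {0 :: 'a}) (\<lambda>x. \<rho> (norm x))"
    by (simp add: reflected_UNIV)
  then obtain A B where AB: "\<And>r. r > 0 \<Longrightarrow> \<rho> r = A * r powr \<beta> + B"
    using radial_p_harmonic[OF _ p(1,3)] unfolding \<beta>_def by blast
  have "connected (- {0 :: 'a})"
    using n by (intro path_connected_imp_connected path_connected_punctured_universe)
  moreover have "- {0 :: 'a} \<noteq> {}" using e nonzero_Basis by blast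
  ultimately have "p_harmonic p (reflected (- {0})) (\<lambda>x :: 'a. \<rho> (norm x) * (inversion x \<bullet> inversion x) powr (\<beta> / 2))"
    using p_harmonic_fundamental_solution[OF p(1), where 'a='a]
    by (intro transform open_punctured) (simp_all add: \<beta>_def)
  then have "p_harmonic p (- {0 :: 'a}) (\<lambda>x. \<rho> (norm x) * norm x powr (- \<beta>))"
    unfolding reflected_punctured
  proof (rule p_harmonic_cong[OF open_punctured, rotated])
    fix x :: 'a
    have "(inversion x \<bullet> inversion x) powr (\<beta> / 2) = norm x powr (- \<beta>)"
      unfolding inversion_facts(2) by (simp add: inverse_powr square_powr powr_minus)
    then show "\<rho> (norm x) * (inversion x \<bullet> inversion x) powr (\<beta> / 2) = \<rho> (norm x) * norm x powr (- \<beta>)"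
      by (simp only:)
  qed
  then obtain A' B' where AB': "\<And>r. r > 0 \<Longrightarrow> \<rho> r * r powr (- \<beta>) = A' * r powr \<beta> + B'"
    using radial_p_harmonic[of p "\<lambda>r. \<rho> r * r powr (- \<beta>)", OF _ p(1,3)] unfolding \<beta>_def by blast
  define c where "c = (2 :: real) powr \<beta>"
  have c: "c > 0" "c \<noteq> 1" using \<beta> by (auto simp: c_def powr_def)
  \<comment> \<open>With \<open>y = r powr \<beta>\<close> the two forms give \<open>A + B / y = A' y + B'\<close>, used at three values of \<open>y\<close>.\<close>
  have "B = 0"
  proof -
    have "(A * r powr \<beta> + B) = (A' * r powr \<beta> + B') * r powr \<beta>" if "r > 0" for r
      using AB[OF that] AB'[OF that] that by (simp add: powr_minus field_simps)
    from this[of 1] this[of 2] this[of 4]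
    have 1: "A + B = A' + B'" and 2: "A * c + B = (A' * c + B') * c" and 3: "A * (c * c) + B = (A' * (c * c) + B') * (c * c)"
      using powr_mult[of 2 2 \<beta>] by (simp_all add: c_def)
    have "(c - 1) * (A - B' - A' * (c + 1)) = 0" using 1 2 by (simp add: algebra_simps)
    moreover have "(c * c - 1) * (A - B' - A' * (c * c + 1)) = 0" using 1 3 by (simp add: algebra_simps)
    moreover have "c * c \<noteq> 1" using c by (metis less_numeral_extra(1) mult.right_neutral mult_less_cancel_left_pos mult_strict_mono linorder_neqE_linordered_idom less_trans not_less_iff_gr_or_eq)
    ultimately have "A - B' = A' * (c + 1)" "A - B' = A' * (c * c + 1)" using c by auto
    then have "A' * (c * (c - 1)) = 0" by (simp add: algebra_simps)
    then have "A' = 0" using c by simp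
    then show "B = 0" using 1 \<open>A - B' = A' * (c + 1)\<close> by simp
  qed
  then have A: "A \<noteq> 0" using AB[OF nz(1)] nz(2) by auto
  define \<gamma> where "\<gamma> = (p - real DIM('a)) / (p - 1) - 2"
  have "p_harmonic p (reflected UNIV) (\<lambda>x :: 'a. \<rho> (norm x) * (inversion x \<bullet> e + 0))"
    using p by (intro transform p_harmonic_affine) auto
  then have "p_harmonic p (- {0}) (\<lambda>x. A * ((x \<bullet> x) powr (\<gamma> / 2) * (x \<bullet> e)))"
    unfolding reflected_UNIV
  proof (rule p_harmonic_cong[OF open_punctured, rotated])
    fix x :: 'a assume "x \<in> - {0}"
    then have x: "norm x > 0" "x \<bullet> x > 0" by auto
    have "(x \<bullet> x) powr (\<gamma> / 2) = norm x powr \<beta> / (x \<bullet> x)"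
    proof -
      have "\<gamma> = \<beta> - 2" by (simp add: \<gamma>_def \<beta>_def)
      moreover have "(x \<bullet> x) powr (\<gamma> / 2) = norm x powr \<gamma>" using square_powr[of x "\<gamma> / 2"] by simp
      ultimately have "(x \<bullet> x) powr (\<gamma> / 2) = norm x powr (\<beta> - 2)" by simp
      also have "\<dots> = norm x powr \<beta> / (x \<bullet> x)"
        using x by (simp add: powr_diff power2_norm_eq_inner)
      finally show ?thesis .
    qed
    then show "\<rho> (norm x) * (inversion x \<bullet> e + 0) = A * ((x \<bullet> x) powr (\<gamma> / 2) * (x \<bullet> e))"
      using x by (simp add: AB \<open>B = 0\<close> inversion_facts)
  qed
  then show False
    using inverted_coordinate_not_p_harmonic[OF e p A \<gamma>_def] by blast
qed

theorem mainTheorem1: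
  fixes p :: real
  assumes "CARD('n::finite) \<ge> 2"
    and "1 < p" and "p \<noteq> 2" and "p \<noteq> real CARD('n)"
  shows "\<not> (\<exists>\<rho> :: real \<Rightarrow> real.
            (\<exists>r>0. \<rho> r \<noteq> 0) \<and>
            (\<forall>(G :: (real ^ 'n) set) (u :: real ^ 'n \<Rightarrow> real).
               open G \<and> connected G \<and> G \<noteq> {} \<and> p_harmonic p G u \<longrightarrow>
               p_harmonic p (reflected G) (\<lambda>x. \<rho> (norm x) * u (inversion x))))"
proof (intro notI, elim exE conjE)
  fix \<rho> :: "real \<Rightarrow> real" and r
  assume "r > 0" "\<rho> r \<noteq> 0"
    and transform: "\<forall>(G :: (real ^ 'n) set) (u :: real ^ 'n \<Rightarrow> real).
       open G \<and> connected G \<and> G \<noteq> {} \<and> p_harmonic p G u \<longrightarrow>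
       p_harmonic p (reflected G) (\<lambda>x. \<rho> (norm x) * u (inversion x))"
  with assms show False
    by (intro no_kelvin_transform[of p r \<rho>, where 'a="real ^ 'n"]) auto
qed


end
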